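(* Let $V_0,V_1,V_2$ be complex vector spaces of dimension $3$ and let $\mathcal{TNS}^\Delta_{(2,2,2),(3,3,3)}\subseteq V_0\otimes V_1\otimes V_2$ be the tensor network variety of the triangle graph with bond dimensions $(2,2,2)$ and local dimensions $(3,3,3)$. Then set-theoretic equations for $\mathcal{TNS}^\Delta_{(2,2,2),(3,3,3)}$ are given by a system of degree $24$ polynomials on $V_0\otimes V_1\otimes V_2$ arising as maximal minors of three $10\times8$ matrices whose entries are cubic forms in the coefficients of $T\in V_0\otimes V_1\otimes V_2$.
   Context: Everything is over $\mathbb C$. With $W_0=W_1=W_2=\mathbb C^2\otimes\mathbb C^2$ having bases $v^{(0)}_{ij},v^{(1)}_{ij},v^{(2)}_{ij}$ ($i,j\in\{0,1\}$), the graph tensor is $T(\Delta,(2,2,2))=\sum_{i,j,k=0}^1v^{(0)}_{ij}\otimes v^{(1)}_{jk}\otimes v^{(2)}_{ki}\in W_0\otimes W_1\otimes W_2$, and $\mathcal{TNS}^\Delta_{(2,2,2),(3,3,3)}\subseteq V_0\otimes V_1\otimes V_2$ is the Zariski closure of the set of all $(X_0\otimes X_1\otimes X_2)(T(\Delta,(2,2,2)))$ with $X_i\in\mathrm{Hom}(W_i,V_i)$. "Set-theoretic equations" means polynomials whose common zero set is the variety. *)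

theory Defs
  imports "HOL-Analysis.Analysis" "HOL-Library.Poly_Mapping"
begin

section \<open>Polynomials on a complex coordinate space\<close>

text \<open>Complex polynomials in variables indexed by \<open>'v\<close>: a monomial is an exponent vector
  \<open>'v \<Rightarrow>\<^sub>0 nat\<close>, and the ring structure (convolution) is the one of \<open>Poly_Mapping\<close>.\<close>

type_synonym 'v polynomial = "('v \<Rightarrow>\<^sub>0 nat) \<Rightarrow>\<^sub>0 complex"

definition eval_poly :: "'v::finite polynomial \<Rightarrow> complex^'v \<Rightarrow> complex" where
  "eval_poly p x =
     (\<Sum>m\<in>Poly_Mapping.keys p.
        Poly_Mapping.lookup p m * (\<Prod>v\<in>UNIV. (x $ v) ^ Poly_Mapping.lookup m v))"

text \<open>As usual, the zero polynomial counts as a form of every degree.\<close>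

definition form_of_degree :: "nat \<Rightarrow> 'v::finite polynomial \<Rightarrow> bool" where
  "form_of_degree d p \<longleftrightarrow>
     (\<forall>m\<in>Poly_Mapping.keys p. (\<Sum>v\<in>UNIV. Poly_Mapping.lookup m v) = d)"

definition zero_locus :: "'v::finite polynomial set \<Rightarrow> (complex^'v) set" where
  "zero_locus P = {x. \<forall>p\<in>P. eval_poly p x = 0}"

definition zariski_closed :: "(complex^'v::finite) set \<Rightarrow> bool" where
  "zariski_closed Z \<longleftrightarrow> (\<exists>P. Z = zero_locus P)"

definition zariski_closure :: "(complex^'v::finite) set \<Rightarrow> (complex^'v) set" where
  "zariski_closure S = zariski_closed hull S"

definition set_theoretic_equations ::
    "'v::finite polynomial set \<Rightarrow> (complex^'v) set \<Rightarrow> bool" where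
  "set_theoretic_equations P Z \<longleftrightarrow> zero_locus P = Z"

text \<open>The maximal minors of a matrix with at least as many rows (\<open>'r\<close>) as columns (\<open>'c\<close>):
  all columns are kept, and the rows are selected, in increasing order, by \<open>s\<close>.\<close>

definition maximal_minors ::
    "'a::comm_ring_1^'c::{finite,linorder}^'r::{finite,linorder} \<Rightarrow> 'a set" where
  "maximal_minors M = {det (\<chi> i j. M $ s i $ j) | s :: 'c \<Rightarrow> 'r. strict_mono s}"


section \<open>The tensor network variety of the triangle\<close>

text \<open>The space \<open>A \<otimes> B \<otimes> C\<close> with \<open>A = \<complex>\<^sup>'\<^sup>a\<close>, \<open>B = \<complex>\<^sup>'\<^sup>b\<close>, \<open>C = \<complex>\<^sup>'\<^sup>c\<close> is
  \<open>complex^('a \<times> 'b \<times> 'c)\<close>, by coefficients in the basis of products of standard basis vectors.\<close>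

definition tensor3 ::
    "complex^'a \<Rightarrow> complex^'b \<Rightarrow> complex^'c \<Rightarrow> complex^('a::finite \<times> 'b::finite \<times> 'c::finite)" where
  "tensor3 u v w = (\<chi> t. case t of (a, b, c) \<Rightarrow> u $ a * v $ b * w $ c)"

text \<open>\<open>X\<^sub>0 \<otimes> X\<^sub>1 \<otimes> X\<^sub>2\<close> as a linear map: the linear extension of
  \<open>e\<^sub>p \<otimes> e\<^sub>q \<otimes> e\<^sub>r \<mapsto> X\<^sub>0 e\<^sub>p \<otimes> X\<^sub>1 e\<^sub>q \<otimes> X\<^sub>2 e\<^sub>r\<close>.\<close>

definition tensor_map ::
    "complex^'p^'a \<Rightarrow> complex^'q^'b \<Rightarrow> complex^'r^'c \<Rightarrow>
     complex^('p::finite \<times> 'q::finite \<times> 'r::finite) \<Rightarrow>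
     complex^('a::finite \<times> 'b::finite \<times> 'c::finite)" where
  "tensor_map X0 X1 X2 T =
     (\<Sum>p\<in>UNIV. \<Sum>q\<in>UNIV. \<Sum>r\<in>UNIV.
        T $ (p, q, r) *s tensor3 (X0 *v axis p 1) (X1 *v axis q 1) (X2 *v axis r 1))"

text \<open>Each \<open>W\<^sub>l = \<complex>\<^sup>2 \<otimes> \<complex>\<^sup>2\<close> is \<open>complex^(2 \<times> 2)\<close>, with \<open>v\<^sub>i\<^sub>j\<close> the standard
  basis vector \<open>axis (i, j) 1\<close>; the two elements of the index type \<open>2\<close> are \<open>0\<close> and \<open>1\<close>.\<close>

definition triangle_tensor :: "complex^((2 \<times> 2) \<times> (2 \<times> 2) \<times> (2 \<times> 2))" where
  "triangle_tensor =
     (\<Sum>i\<in>UNIV. \<Sum>j\<in>UNIV. \<Sum>k\<in>UNIV.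
        tensor3 (axis (i, j) 1) (axis (j, k) 1) (axis (k, i) 1))"

text \<open>Bond dimensions \<open>(2,2,2)\<close>; the local dimensions are the cardinalities of the index types.\<close>

definition TNS_triangle :: "(complex^('a::finite \<times> 'b::finite \<times> 'c::finite)) set" where
  "TNS_triangle = zariski_closure
     {tensor_map X0 X1 X2 triangle_tensor |
        (X0 :: complex^(2 \<times> 2)^'a) (X1 :: complex^(2 \<times> 2)^'b) (X2 :: complex^(2 \<times> 2)^'c). True}"

end

theory Submission
  imports Defs "HOL-Computational_Algebra.Fundamental_Theorem_Algebra"
begin

text \<open>
  For \<open>T \<in> A \<otimes> B \<otimes> C\<close> each of the three slicings gives a ternary cubic, the determinant of a
  \<open>3 \<times> 3\<close> matrix of linear forms. The \<open>10 \<times> 8\<close> matrices are those of \<open>sl\<^sub>3 \<rightarrow> S\<^sup>3\<close>, \<open>X \<mapsto> X \<cdot> F\<close>, for these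
  cubics \<open>F\<close>: the maximal minors vanish iff a nonzero traceless \<open>X\<close> annihilates \<open>F\<close>.

  If \<open>T\<close> is a restriction \<open>tr (A(u) B(v) C(w))\<close> of the triangle tensor, Cauchy--Binet gives
  \<open>F = q \<cdot> l\<close> with \<open>q = det A(u)\<close> quadratic and \<open>l\<close> linear, and the infinitesimal rotation
  \<open>X v = l \<times> Q v\<close> annihilates both factors.

  Conversely, a cubic annihilated by some \<open>X \<noteq> 0\<close> vanishes on a plane. By Kronecker's
  analysis of singular pencils, each slicing then yields a vanishing \<open>2 \<times> 2 \<times> 2\<close> block of \<open>T\<close> or a slice
  of rank at most one in another direction; rank-one slices in two directions again
  force a vanishing block. Finally, a generic tensor with a vanishing \<open>2 \<times> 2 \<times> 2\<close> block is
  equivalent to \<open>(a \<cdot> b) (n \<cdot> c) + det (a, b, c)\<close>, which is a restriction by the multiplication rule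
  of the Pauli matrices, so every such tensor is a limit of restrictions.
\<close>

section \<open>Evaluation, degrees and maximal minors\<close>

text \<open>The size of the matrices is dim S^3(C^3) = 10 by dim sl_3 = 8. Tracelessness is
  essential: the cuspidal cubic y^2 z = x^3 is irreducible, yet diag(0, 1, -2), of nonzero trace,
  annihilates it. A plane in the zero set of one slice determinant only says that a pencil of slices
  is singular. Besides a vanishing block such a pencil may have a common kernel on one side, which
  is why one slicing does not decide and all three enter: the exceptional cases of different
  slicings are played against each other. Limits need no dimension theory. Zero loci are closed in
  the Euclidean topology, and along a suitable line T + t R every genericity condition is a nonzero
  polynomial in t, so it fails for finitely many t only. Derivatives are replaced by polarisation:
  if P is the symmetric trilinear form of a cubic F, the value of X . F at v is a constant times P v
  v (X v).\<close>

definition eval_monomial :: "('v::finite \<Rightarrow>\<^sub>0 nat) \<Rightarrow> complex^'v \<Rightarrow> complex" where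
  "eval_monomial m x = (\<Prod>v\<in>UNIV. (x $ v) ^ Poly_Mapping.lookup m v)"

lemma eval_monomial_add: "eval_monomial (m + n) x = eval_monomial m x * eval_monomial n x"
  by (simp add: eval_monomial_def lookup_add power_add prod.distrib)

lemma eval_poly_superset:
  assumes "finite K" "Poly_Mapping.keys p \<subseteq> K"
  shows "eval_poly p x = (\<Sum>m\<in>K. Poly_Mapping.lookup p m * eval_monomial m x)"
  unfolding eval_poly_def eval_monomial_def
  by (rule sum.mono_neutral_left) (use assms in \<open>auto simp: in_keys_iff\<close>)

lemma eval_poly_0 [simp]: "eval_poly 0 x = 0"
  by (simp add: eval_poly_def)

lemma eval_poly_add: "eval_poly (p + q) x = eval_poly p x + eval_poly q x"
proof -
  let ?K = "Poly_Mapping.keys p \<union> Poly_Mapping.keys q"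
  have "Poly_Mapping.keys (p + q) \<subseteq> ?K" by (rule keys_add)
  then show ?thesis
    by (simp add: eval_poly_superset[of ?K] lookup_add algebra_simps sum.distrib)
qed

lemma eval_poly_single: "eval_poly (Poly_Mapping.single m c) x = c * eval_monomial m x"
  by (subst eval_poly_superset[of "{m}"]) auto

lemma eval_poly_uminus: "eval_poly (- p) x = - eval_poly p x"
  by (metis add.left_inverse add_eq_0_iff eval_poly_0 eval_poly_add)

lemma polynomial_induct [case_names single add]:
  fixes p :: "'v polynomial"
  assumes "\<And>m c. P (Poly_Mapping.single m c)" "\<And>p q. P p \<Longrightarrow> P q \<Longrightarrow> P (p + q)"
  shows "P p"
proof (induction p rule: update_induct)
  case const
  then show ?case by (metis assms(1) single_zero)
next
  case (update f m c)
  have "Poly_Mapping.update m c f = f + Poly_Mapping.single m c"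
    using update by (intro poly_mapping_eqI) (auto simp: lookup_update lookup_add lookup_single when_def in_keys_iff)
  then show ?case using assms update by auto
qed

lemma eval_poly_mult: "eval_poly (p * q) x = eval_poly p x * eval_poly q x"
proof (induction p rule: polynomial_induct)
  case (single m c)
  then show ?case
  proof (induction q rule: polynomial_induct)
    case (single n d)
    then show ?case by (simp add: mult_single eval_poly_single eval_monomial_add)
  next
    case (add p q)
    then show ?case by (simp add: algebra_simps eval_poly_add)
  qed
next
  case (add p q)
  then show ?case by (simp add: algebra_simps eval_poly_add)
qed

lemma eval_poly_1 [simp]: "eval_poly 1 x = 1"
  using eval_poly_single[of 0 1 x] by (simp add: single_one eval_monomial_def)

lemma eval_poly_sum: "eval_poly (\<Sum>i\<in>I. f i) x = (\<Sum>i\<in>I. eval_poly (f i) x)"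
  by (induction I rule: infinite_finite_induct) (auto simp: eval_poly_add)

lemma eval_poly_prod: "eval_poly (\<Prod>i\<in>I. f i) x = (\<Prod>i\<in>I. eval_poly (f i) x)"
  by (induction I rule: infinite_finite_induct) (auto simp: eval_poly_mult)

lemma eval_poly_of_int_sign: "eval_poly (of_int (sign p)) x = of_int (sign p)"
  by (simp add: sign_def eval_poly_uminus)

lemma eval_poly_det:
  "eval_poly (det A) x = det (\<chi> i j. eval_poly (A $ i $ j) x)"
  by (simp add: det_def eval_poly_sum eval_poly_mult eval_poly_prod eval_poly_of_int_sign)

lemma form_of_degree_add:
  "form_of_degree d p \<Longrightarrow> form_of_degree d q \<Longrightarrow> form_of_degree d (p + q)"
  using keys_add[of p q] by (auto simp: form_of_degree_def)

lemma form_of_degree_0: "form_of_degree d 0"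
  by (simp add: form_of_degree_def)

lemma form_of_degree_sum:
  "(\<And>i. i \<in> I \<Longrightarrow> form_of_degree d (f i)) \<Longrightarrow> form_of_degree d (\<Sum>i\<in>I. f i)"
  by (induction I rule: infinite_finite_induct) (auto simp: form_of_degree_add form_of_degree_0)

lemma form_of_degree_mult:
  "form_of_degree d p \<Longrightarrow> form_of_degree e q \<Longrightarrow> form_of_degree (d + e) (p * q)"
  using keys_mult[of p q] by (force simp: form_of_degree_def lookup_add sum.distrib)

lemma form_of_degree_uminus: "form_of_degree d p \<Longrightarrow> form_of_degree d (- p)"
  by (simp add: form_of_degree_def in_keys_iff)

lemma form_of_degree_1: "form_of_degree 0 1"
  by (auto simp: form_of_degree_def)

lemma form_of_degree_prod:
  "finite I \<Longrightarrow> (\<And>i. i \<in> I \<Longrightarrow> form_of_degree d (f i)) \<Longrightarrow> form_of_degree (card I * d) (\<Prod>i\<in>I. f i)"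
  by (induction I rule: finite_induct) (auto simp: form_of_degree_1 form_of_degree_mult)

lemma form_of_degree_det:
  fixes A :: "'v::finite polynomial^'n^'n"
  assumes "\<And>i j. form_of_degree d (A $ i $ j)"
  shows "form_of_degree (CARD('n) * d) (det A)"
  unfolding det_def
proof (rule form_of_degree_sum)
  fix p :: "'n \<Rightarrow> 'n"
  have 1: "form_of_degree (CARD('n) * d) (\<Prod>i\<in>UNIV. A $ i $ p i)"
    by (intro form_of_degree_prod assms) auto
  have "of_int (sign p) = (1 :: 'v polynomial) \<or> of_int (sign p) = (- 1 :: 'v polynomial)"
    by (simp add: sign_def)
  then show "form_of_degree (CARD('n) * d) (of_int (sign p) * (\<Prod>i\<in>UNIV. A $ i $ p i))"
    using form_of_degree_mult[OF form_of_degree_1 1]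
      form_of_degree_mult[OF form_of_degree_uminus[OF form_of_degree_1] 1]
    by auto
qed

lemma continuous_on_eval_poly: "continuous_on UNIV (eval_poly p)"
  unfolding eval_poly_def by (intro continuous_intros)

lemma closed_zero_locus: "closed (zero_locus P)"
proof -
  have "zero_locus P = (\<Inter>p\<in>P. eval_poly p -` {0})"
    by (auto simp: zero_locus_def)
  then show ?thesis
    by (metis closed_INT closed_singleton closed_vimage continuous_on_eval_poly)
qed

text \<open>Polynomials are continuous, so limits of restrictions already lie in the tensor network
  variety; the converse direction produces only such limits.\<close>

lemma closure_subset_zariski_closure: "closure S \<subseteq> zariski_closure S"
proof -
  have "closure S \<subseteq> Z" if "zariski_closed Z" "S \<subseteq> Z" for Z
    using that closed_zero_locus closure_minimal unfolding zariski_closed_def by metis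
  then show ?thesis unfolding zariski_closure_def hull_def by blast
qed

lemma zariski_closure_subset: "S \<subseteq> zero_locus P \<Longrightarrow> zariski_closure S \<subseteq> zero_locus P"
  unfolding zariski_closure_def by (rule hull_minimal) (auto simp: zariski_closed_def)

section \<open>Maximal minors and kernel vectors\<close>

lemma det_0_iff_ker:
  fixes A :: "'a::field^'n^'n"
  shows "det A = 0 \<longleftrightarrow> (\<exists>x. x \<noteq> 0 \<and> A *v x = 0)"
  using invertible_det_nz[of A] matrix_left_invertible_ker[of A] invertible_left_inverse[of A] by blast

text \<open>\<open>maximal_minors\<close> admits only increasing row selections; this turns a set of
  rows of the right size into one. The index \<open>j\<close> is sent to the entry of the sorted
  list whose position is the number of indices below \<open>j\<close>.\<close>

lemma strict_mono_enumeration: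
  fixes R :: "'r::{finite,linorder} set"
  assumes "card R = CARD('c::{finite,linorder})"
  shows "\<exists>s :: 'c \<Rightarrow> 'r. strict_mono s \<and> range s = R"
proof -
  define xs where "xs = sorted_list_of_set R"
  define n where "n j = card {i. i < (j::'c)}" for j
  have xs: "sorted_wrt (<) xs" "set xs = R" "length xs = CARD('c)"
    using assms by (auto simp: xs_def)
  have nlt: "n j < CARD('c)" for j
    unfolding n_def by (rule psubset_card_mono) auto
  have nmono: "n i < n j" if "i < j" for i j
    unfolding n_def by (rule psubset_card_mono) (use that in auto)
  define s where "s j = xs ! n j" for j
  have "strict_mono s"
    unfolding s_def by (rule strict_monoI) (metis nmono nlt xs sorted_wrt_iff_nth_less)
  moreover have "range s = R"
  proof (rule card_subset_eq)
    show "range s \<subseteq> R" unfolding s_def using nlt xs nth_mem by fastforce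
    show "card (range s) = card R"
      using assms calculation by (simp add: card_image strict_mono_imp_inj_on)
  qed auto
  ultimately show ?thesis by blast
qed

text \<open>A trivial kernel means that the rows span. They then contain a basis, which has as many
  members as there are columns, and listed increasingly it gives a nonzero minor.\<close>

lemma maximal_minors_vanish_iff:
  fixes A :: "'a::field^'c::{finite,linorder}^'r::{finite,linorder}"
  shows "(\<forall>s :: 'c \<Rightarrow> 'r. strict_mono s \<longrightarrow> det (\<chi> i j. A $ s i $ j) = 0) \<longleftrightarrow> (\<exists>x. x \<noteq> 0 \<and> A *v x = 0)"
proof (intro iffI)
  assume minors: "\<forall>s :: 'c \<Rightarrow> 'r. strict_mono s \<longrightarrow> det (\<chi> i j. A $ s i $ j) = 0"
  show "\<exists>x. x \<noteq> 0 \<and> A *v x = 0"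
  proof (rule ccontr)
    assume "\<not> ?thesis"
    then have "vec.span (rows A) = UNIV"
      by (metis matrix_left_invertible_ker matrix_left_invertible_span_rows_gen)
    moreover obtain B where B: "B \<subseteq> rows A" "vec.independent B" "rows A \<subseteq> vec.span B"
      using vec.maximal_independent_subset by metis
    ultimately have span: "vec.span B = UNIV"
      by (metis top.extremum_uniqueI vec.span_mono vec.span_span)
    then have cB: "card B = CARD('c)"
      using B by (metis vec.dim_span_eq_card_independent vec.dim_UNIV vec_dim_card)
    have "\<forall>b\<in>B. \<exists>i. A $ i = b" using B by (auto simp: rows_def row_def)
    then obtain r where r: "\<And>b. b \<in> B \<Longrightarrow> A $ r b = b" by metis
    have "inj_on r B" by (metis inj_onI r)
    then have "card (r ` B) = CARD('c)" by (simp add: cB card_image)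
    then obtain s :: "'c \<Rightarrow> 'r" where s: "strict_mono s" "range s = r ` B"
      using strict_mono_enumeration by blast
    let ?N = "\<chi> i j. A $ s i $ j"
    have "B \<subseteq> rows ?N"
    proof
      fix b assume "b \<in> B"
      then obtain i where "s i = r b" using s(2) by (metis imageE imageI)
      then have "row i ?N = b" using r[OF \<open>b \<in> B\<close>] by (simp add: row_def vec_eq_iff)
      then show "b \<in> rows ?N" by (auto simp: rows_def)
    qed
    then have "vec.span (rows ?N) = UNIV"
      by (metis span top.extremum_uniqueI vec.span_mono)
    then have "invertible ?N"
      by (metis invertible_left_inverse matrix_left_invertible_span_rows_gen)
    then show False using minors s(1) invertible_det_nz by blast
  qed
next
  assume "\<exists>x. x \<noteq> 0 \<and> A *v x = 0"
  then obtain x where x: "x \<noteq> 0" "A *v x = 0" by blast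
  have "(\<chi> i j. A $ s i $ j) *v x = 0" for s :: "'c \<Rightarrow> 'r"
    using x(2) by (simp add: vec_eq_iff matrix_vector_mult_def)
  then show "\<forall>s :: 'c \<Rightarrow> 'r. strict_mono s \<longrightarrow> det (\<chi> i j. A $ s i $ j) = 0"
    using x(1) det_0_iff_ker by blast
qed

lemma zero_locus_maximal_minors:
  "x \<in> zero_locus (\<Union>l. maximal_minors (M l)) \<longleftrightarrow>
    (\<forall>l. \<exists>y. y \<noteq> 0 \<and> (\<chi> i j. eval_poly (M l $ i $ j) x) *v y = 0)"
proof -
  have "x \<in> zero_locus (\<Union>l. maximal_minors (M l)) \<longleftrightarrow>
    (\<forall>l s. strict_mono s \<longrightarrow> eval_poly (det (\<chi> i j. M l $ s i $ j)) x = 0)"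
    unfolding zero_locus_def maximal_minors_def by blast
  then show ?thesis
    unfolding maximal_minors_vanish_iff[symmetric] by (simp add: eval_poly_det)
qed

lemma form_of_degree_maximal_minor:
  fixes M :: "'v::finite polynomial^'c::{finite,linorder}^'r::{finite,linorder}"
  assumes "\<And>i j. form_of_degree d (M $ i $ j)" "p \<in> maximal_minors M"
  shows "form_of_degree (CARD('c) * d) p"
  using assms by (auto simp: maximal_minors_def intro!: form_of_degree_det)

section \<open>Restrictions of the triangle tensor\<close>

definition tau :: "complex^(3 \<times> 3 \<times> 3) \<Rightarrow> complex^3 \<Rightarrow> complex^3 \<Rightarrow> complex^3 \<Rightarrow> complex" where
  "tau T a b c = (\<Sum>i\<in>UNIV. \<Sum>j\<in>UNIV. \<Sum>k\<in>UNIV. T $ (i, j, k) * a $ i * b $ j * c $ k)"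

lemmas tau_expand = tau_def sum_3

lemma tau_add:
  "tau T (a + a') b c = tau T a b c + tau T a' b c"
  "tau T a (b + b') c = tau T a b c + tau T a b' c"
  "tau T a b (c + c') = tau T a b c + tau T a b c'"
  by (simp_all add: tau_def sum.distrib algebra_simps)

lemma tau_scale:
  "tau T (s *s a) b c = s * tau T a b c"
  "tau T a (s *s b) c = s * tau T a b c"
  "tau T a b (s *s c) = s * tau T a b c"
  by (simp_all add: tau_expand algebra_simps)

lemma tau_zero [simp]: "tau T 0 b c = 0" "tau T a 0 c = 0" "tau T a b 0 = 0"
  by (simp_all add: tau_def)

lemma tau_axis: "tau T (axis i 1) (axis j 1) (axis k 1) = T $ (i, j, k)"
  using exhaust_3[of i] exhaust_3[of j] exhaust_3[of k] by (auto simp: tau_expand axis_def)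

text \<open>The restrictions in matrix form: row \<open>i\<close> of \<open>X0\<close> is an element
  of the tensor square of C^2, read here as the 2 x 2 matrix \<open>A i\<close>; contracting the
  three bonds is then a trace.\<close>

definition triangle_restrictions :: "(complex^(3 \<times> 3 \<times> 3)) set" where
  "triangle_restrictions =
     {T. \<exists>(A :: 3 \<Rightarrow> complex^2^2) (B :: 3 \<Rightarrow> complex^2^2) (C :: 3 \<Rightarrow> complex^2^2). \<forall>i j k. T $ (i, j, k) = trace (A i ** B j ** C k)}"

lemma triangle_restrictionsI:
  fixes A B C :: "3 \<Rightarrow> complex^2^2"
  shows "(\<And>i j k. T $ (i, j, k) = trace (A i ** B j ** C k)) \<Longrightarrow> T \<in> triangle_restrictions"
  unfolding triangle_restrictions_def by blast

lemma sum_pair_2: "sum f (UNIV :: (2 \<times> 2) set) = f (1, 1) + f (1, 2) + f (2, 1) + f (2, 2)"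
  for f :: "_ \<Rightarrow> 'a::comm_monoid_add"
proof -
  have "UNIV = {(1, 1), (1, 2), (2, 1), (2, 2) :: 2 \<times> 2}"
    using exhaust_2 by auto
  then have "sum f UNIV = sum f {(1, 1), (1, 2), (2, 1), (2, 2)}" by (rule arg_cong)
  then show ?thesis by (simp add: add.assoc)
qed

lemma trace_mult_3:
  fixes A B C :: "complex^2^2"
  shows "trace (A ** B ** C) = (\<Sum>i\<in>UNIV. \<Sum>j\<in>UNIV. \<Sum>k\<in>UNIV. A $ i $ j * B $ j $ k * C $ k $ i)"
  by (simp add: trace_def matrix_matrix_mult_def sum_2 algebra_simps)

lemma sum_delta_2:
  fixes a b d :: 2 and c :: complex
  shows "(\<Sum>i\<in>UNIV. \<Sum>j\<in>UNIV. \<Sum>k\<in>UNIV. if i = a \<and> j = b \<and> k = d then c else 0) = c"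
  using exhaust_2[of a] exhaust_2[of b] exhaust_2[of d] by (elim disjE) (simp_all add: sum_2)

lemma triangle_tensor_nth:
  "triangle_tensor $ (p, q, r) = (if snd p = fst q \<and> snd q = fst r \<and> snd r = fst p then 1 else 0)"
proof -
  have "triangle_tensor $ (p, q, r) = (\<Sum>i\<in>UNIV. \<Sum>j\<in>UNIV. \<Sum>k\<in>UNIV.
      if i = fst p \<and> j = snd p \<and> k = snd q
      then if snd p = fst q \<and> snd q = fst r \<and> snd r = fst p then 1 else 0 else 0)"
    unfolding triangle_tensor_def tensor3_def sum_component
    by (intro sum.cong refl) (auto simp: axis_def prod_eq_iff)
  also have "\<dots> = (if snd p = fst q \<and> snd q = fst r \<and> snd r = fst p then 1 else 0)"
    by (rule sum_delta_2)
  finally show ?thesis .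
qed

lemma tensor_map_triangle:
  fixes X0 :: "complex^(2 \<times> 2)^3" and X1 :: "complex^(2 \<times> 2)^3" and X2 :: "complex^(2 \<times> 2)^3"
  shows "tensor_map X0 X1 X2 triangle_tensor $ (a, b, c) =
    (\<Sum>i\<in>UNIV. \<Sum>j\<in>UNIV. \<Sum>k\<in>UNIV. X0 $ a $ (i, j) * X1 $ b $ (j, k) * X2 $ c $ (k, i))"
proof -
  have "(X *v axis p 1) $ i = X $ i $ p" for X :: "complex^(2 \<times> 2)^3" and i p
    by (simp add: matrix_vector_mult_def axis_def if_distrib cong: if_cong)
  then show ?thesis
    by (simp add: tensor_map_def sum_pair_2 triangle_tensor_nth tensor3_def sum_2)
qed

lemma tensor_map_triangle_image:
  "{tensor_map X0 X1 X2 triangle_tensor |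
      (X0 :: complex^(2 \<times> 2)^3) (X1 :: complex^(2 \<times> 2)^3) (X2 :: complex^(2 \<times> 2)^3). True}
    = triangle_restrictions"
proof (intro equalityI subsetI)
  fix T :: "complex^(3 \<times> 3 \<times> 3)"
  assume "T \<in> {tensor_map X0 X1 X2 triangle_tensor |
      (X0 :: complex^(2 \<times> 2)^3) (X1 :: complex^(2 \<times> 2)^3) (X2 :: complex^(2 \<times> 2)^3). True}"
  then obtain X0 X1 X2 :: "complex^(2 \<times> 2)^3" where "T = tensor_map X0 X1 X2 triangle_tensor"
    by blast
  then show "T \<in> triangle_restrictions"
    unfolding triangle_restrictions_def mem_Collect_eq
    by (intro exI[of _ "\<lambda>a. \<chi> i j. X0 $ a $ (i, j)"] exI[of _ "\<lambda>a. \<chi> i j. X1 $ a $ (i, j)"]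
        exI[of _ "\<lambda>a. \<chi> i j. X2 $ a $ (i, j)"]) (simp add: trace_mult_3 tensor_map_triangle)
next
  fix T assume "T \<in> triangle_restrictions"
  then obtain A B C :: "3 \<Rightarrow> complex^2^2" where T: "\<And>i j k. T $ (i, j, k) = trace (A i ** B j ** C k)"
    unfolding triangle_restrictions_def by blast
  define X where "X A = (\<chi> a p. A a $ fst p $ snd p)" for A :: "3 \<Rightarrow> complex^2^2"
  have "T = tensor_map (X A) (X B) (X C) triangle_tensor"
    by (auto simp: vec_eq_iff T trace_mult_3 tensor_map_triangle X_def)
  then show "T \<in> {tensor_map X0 X1 X2 triangle_tensor |
      (X0 :: complex^(2 \<times> 2)^3) (X1 :: complex^(2 \<times> 2)^3) (X2 :: complex^(2 \<times> 2)^3). True}"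
    by blast
qed

text \<open>For invertible \<open>G\<close>, \<open>H\<close>, \<open>L\<close> this is a change of
  basis in the three factors: their rows are the new basis vectors written in the old ones.\<close>

definition act :: "complex^3^3 \<Rightarrow> complex^3^3 \<Rightarrow> complex^3^3 \<Rightarrow> complex^(3 \<times> 3 \<times> 3) \<Rightarrow> complex^(3 \<times> 3 \<times> 3)" where
  "act G H L T = (\<chi> t. tau T (G $ fst t) (H $ fst (snd t)) (L $ snd (snd t)))"

lemma act_nth [simp]: "act G H L T $ (i, j, k) = tau T (G $ i) (H $ j) (L $ k)"
  by (simp add: act_def)

lemma row_matrix_mult: "(A ** B) $ i = (\<Sum>p\<in>UNIV. A $ i $ p *s B $ p)"
  for A B :: "complex^3^3"
  by (simp add: vec_eq_iff matrix_matrix_mult_def)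

lemma act_act: "act G H L (act G' H' L' T) = act (G ** G') (H ** H') (L ** L') T"
proof -
  have "tau (act G' H' L' T) a b c =
    tau T (\<Sum>p\<in>UNIV. a $ p *s G' $ p) (\<Sum>p\<in>UNIV. b $ p *s H' $ p) (\<Sum>p\<in>UNIV. c $ p *s L' $ p)" for a b c
    unfolding tau_def[of "act _ _ _ _"] sum_3 act_nth by (simp add: tau_add tau_scale algebra_simps)
  then show ?thesis
    by (simp add: vec_eq_iff row_matrix_mult)
qed

lemma act_id [simp]: "act (mat 1) (mat 1) (mat 1) T = T"
proof -
  have "(mat 1 :: complex^3^3) $ i = axis i 1" for i by (simp add: vec_eq_iff mat_def axis_def)
  then show ?thesis
    unfolding vec_eq_iff[of _ T] split_paired_all split_paired_All act_nth by (simp only: tau_axis simp_thms)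
qed

definition lincomb :: "(3 \<Rightarrow> complex^2^2) \<Rightarrow> complex^3 \<Rightarrow> complex^2^2" where
  "lincomb A a = (\<chi> r s. \<Sum>i\<in>UNIV. a $ i * A i $ r $ s)"

lemma trace_lincomb:
  "trace (lincomb A a ** Y ** Z) = (\<Sum>i\<in>UNIV. a $ i * trace (A i ** Y ** Z))"
  "trace (X ** lincomb A a ** Z) = (\<Sum>i\<in>UNIV. a $ i * trace (X ** A i ** Z))"
  "trace (X ** Y ** lincomb A a) = (\<Sum>i\<in>UNIV. a $ i * trace (X ** Y ** A i))"
  by (simp_all add: trace_mult_3 lincomb_def sum_2 sum_3 algebra_simps)

lemma tau_restriction:
  assumes "\<And>i j k. T $ (i, j, k) = trace (A i ** B j ** C k)"
  shows "tau T a b c = trace (lincomb A a ** lincomb B b ** lincomb C c)"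
  unfolding tau_expand assms trace_lincomb by (simp add: algebra_simps)

lemma act_triangle_restrictions:
  assumes "T \<in> triangle_restrictions"
  shows "act G H L T \<in> triangle_restrictions"
proof -
  obtain A B C :: "3 \<Rightarrow> complex^2^2" where "\<And>i j k. T $ (i, j, k) = trace (A i ** B j ** C k)"
    using assms unfolding triangle_restrictions_def by blast
  from tau_restriction[OF this] show ?thesis
    unfolding triangle_restrictions_def mem_Collect_eq
    by (intro exI[of _ "\<lambda>i. lincomb A (G $ i)"] exI[of _ "\<lambda>i. lincomb B (H $ i)"]
        exI[of _ "\<lambda>i. lincomb C (L $ i)"]) simp
qed

lemma continuous_on_act: "continuous_on UNIV (act G H L)"
  unfolding act_def tau_def by (intro continuous_intros continuous_on_vec_lambda)

lemma act_closure:
  "T \<in> closure triangle_restrictions \<Longrightarrow> act G H L T \<in> closure triangle_restrictions"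
  using image_closure_subset[of triangle_restrictions "act G H L" "closure triangle_restrictions"]
    continuous_on_subset[OF continuous_on_act] act_triangle_restrictions closure_subset by fastforce

lemma closure_actI:
  assumes "invertible G" "invertible H" "invertible L" "act G H L T \<in> closure triangle_restrictions"
  shows "T \<in> closure triangle_restrictions"
proof -
  obtain G' H' L' where "G' ** G = mat 1" "H' ** H = mat 1" "L' ** L = mat 1"
    using assms invertible_left_inverse by metis
  then show ?thesis using act_closure[OF assms(4), of G' H' L'] by (simp add: act_act)
qed

text \<open>The complement of a finite set is dense in the complex line. This removes every
  genericity assumption made along the way.\<close>

lemma closed_perturb:
  fixes Z :: "(complex^'n) set"
  assumes "closed Z" "finite E" "\<And>t::complex. t \<notin> E \<Longrightarrow> T + t *s R \<in> Z"
  shows "T \<in> Z"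
proof -
  let ?g = "\<lambda>t. T + t *s R"
  have "continuous_on UNIV ?g"
    unfolding vector_scalar_mult_def by (intro continuous_intros continuous_on_vec_lambda)
  then have "closed (?g -` Z)" using assms(1) closed_vimage by blast
  moreover have "- E \<subseteq> ?g -` Z" using assms(3) by auto
  moreover have "closure (- E) = UNIV"
    using assms(2) by (simp add: closure_complement empty_interior_finite)
  ultimately have "0 \<in> ?g -` Z" by (metis UNIV_I closure_minimal in_mono)
  then show ?thesis by simp
qed

section \<open>Independent pairs, adapted bases and vanishing blocks\<close>

definition indep :: "complex^3 \<Rightarrow> complex^3 \<Rightarrow> bool" where
  "indep u v \<longleftrightarrow> (\<forall>s t. s *s u + t *s v = 0 \<longrightarrow> s = 0 \<and> t = 0)"

lemma invertible_vector_3_iff: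
  "invertible (vector [u, v, w] :: complex^3^3) \<longleftrightarrow>
    (\<forall>r s t. r *s u + s *s v + t *s w = 0 \<longrightarrow> r = 0 \<and> s = 0 \<and> t = 0)"
proof -
  let ?A = "vector [u, v, w] :: complex^3^3"
  have *: "transpose ?A *v vector [r, s, t] = r *s u + s *s v + t *s w" for r s t
    by (simp add: vec_eq_iff matrix_vector_mult_def transpose_def sum_3 mult.commute)
  have "invertible ?A \<longleftrightarrow> (\<forall>x. transpose ?A *v x = 0 \<longrightarrow> x = 0)"
    by (metis det_0_iff_ker det_transpose invertible_det_nz)
  also have "\<dots> \<longleftrightarrow> (\<forall>r s t. transpose ?A *v vector [r, s, t] = 0 \<longrightarrow> (vector [r, s, t] :: complex^3) = 0)"
    by (rule forall_vector_3)
  finally show ?thesis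
    unfolding * by (simp add: vec_eq_iff[of "vector _"] forall_3)
qed

text \<open>If no standard basis vector completed the pair, all its 2 x 2 minors would vanish, and
  then \<open>v$i *s u - u$i *s v = 0\<close> would be a dependence for each
  \<open>i\<close>.\<close>

lemma indep_extend:
  assumes "indep u v"
  shows "\<exists>w. invertible (vector [w, u, v] :: complex^3^3)"
proof (rule ccontr)
  assume "\<not> ?thesis"
  then have *: "det (vector [w, u, v] :: complex^3^3) = 0" for w
    using invertible_det_nz by blast
  have c: "u$2 * v$3 = u$3 * v$2" "u$1 * v$3 = u$3 * v$1" "u$1 * v$2 = u$2 * v$1"
    using *[of "axis 1 1"] *[of "axis 2 1"] *[of "axis 3 1"] by (simp_all add: det_3 axis_def)
  have "v$i *s u + (- u$i) *s v = 0" for i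
    using c exhaust_3[of i] by (auto simp: vec_eq_iff forall_3 algebra_simps)
  then have "v$i = 0" "u$i = 0" for i
    using assms unfolding indep_def by (metis neg_equal_0_iff_equal)+
  then have "1 *s u + 0 *s v = 0" by (simp add: vec_eq_iff)
  then show False using assms unfolding indep_def by (metis zero_neq_one)
qed

definition zero_block :: "complex^(3 \<times> 3 \<times> 3) \<Rightarrow> bool" where
  "zero_block T \<longleftrightarrow> (\<exists>a a' b b' c c'. indep a a' \<and> indep b b' \<and> indep c c' \<and>
    (\<forall>x\<in>{a, a'}. \<forall>y\<in>{b, b'}. \<forall>z\<in>{c, c'}. tau T x y z = 0))"

lemma zero_block_normalize:
  assumes "zero_block T"
  obtains G H L where "invertible G" "invertible H" "invertible L"
    "\<And>i j k. i \<noteq> 1 \<Longrightarrow> j \<noteq> 1 \<Longrightarrow> k \<noteq> 1 \<Longrightarrow> act G H L T $ (i, j, k) = 0"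
proof -
  obtain a a' b b' c c' where ind: "indep a a'" "indep b b'" "indep c c'"
    and z: "\<forall>x\<in>{a, a'}. \<forall>y\<in>{b, b'}. \<forall>z\<in>{c, c'}. tau T x y z = 0"
    using assms unfolding zero_block_def by blast
  obtain u v w where *: "invertible (vector [u, a, a'] :: complex^3^3)"
    "invertible (vector [v, b, b'] :: complex^3^3)" "invertible (vector [w, c, c'] :: complex^3^3)"
    using ind indep_extend by metis
  have "act (vector [u, a, a']) (vector [v, b, b']) (vector [w, c, c']) T $ (i, j, k) = 0"
    if "i \<noteq> 1" "j \<noteq> 1" "k \<noteq> 1" for i j k
    using that z exhaust_3[of i] exhaust_3[of j] exhaust_3[of k] by auto
  with * show thesis using that by blast
qed

section \<open>Tensors with a vanishing block are limits of restrictions\<close>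

definition eps :: "3 \<Rightarrow> 3 \<Rightarrow> 3 \<Rightarrow> complex" where
  "eps i j k = det (vector [axis i 1, axis j 1, axis k 1])"

lemma eps_simps [simp]:
  "eps 1 2 3 = 1" "eps 2 3 1 = 1" "eps 3 1 2 = 1"
  "eps 2 1 3 = -1" "eps 3 2 1 = -1" "eps 1 3 2 = -1"
  "eps i i j = 0" "eps i j i = 0" "eps j i i = 0"
  by (simp_all add: eps_def det_3 axis_def)

definition pauli :: "3 \<Rightarrow> complex^2^2" where
  "pauli i = (if i = 1 then vector [vector [0, 1], vector [1, 0]]
    else if i = 2 then vector [vector [0, - \<i>], vector [\<i>, 0]]
    else vector [vector [1, 0], vector [0, - 1]])"

text \<open>The Pauli matrices multiply as s_i s_j = delta_ij + \<i> eps_ijl s_l. Against C k = n_k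
  / 2 - (\<i> / 2) s_k the trace picks out delta_ij n_k from the scalar part and eps_ijk from the
  rest.\<close>

lemma pauli_restriction:
  "(\<chi> t. case t of (i, j, k) \<Rightarrow> (if i = j then n $ k else 0) + eps i j k) \<in> triangle_restrictions"
proof -
  define C where "C k = (\<chi> r s. (if r = s then n $ k / 2 else 0) - \<i> / 2 * pauli k $ r $ s)" for k
  have "(if i = j then n $ k else 0) + eps i j k = trace (pauli i ** pauli j ** C k)" for i j k
    unfolding trace_mult_3 sum_2 C_def
    using exhaust_3[of i] exhaust_3[of j] exhaust_3[of k]
    by (elim disjE) (simp_all add: pauli_def field_simps)
  then show ?thesis
    by (intro triangle_restrictionsI[of _ pauli pauli C]) simp
qed

text \<open>Applying \<open>g\<close> in all three factors turns the Kronecker delta into the Gram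
  matrix \<open>g ** transpose g\<close> and multiplies \<open>eps\<close> by \<open>det g\<close>;
  dividing the third factor by \<open>det g\<close> restores \<open>eps\<close>.\<close>

lemma gram_restriction:
  assumes "det g \<noteq> 0"
  shows "(\<chi> t. case t of (i, j, k) \<Rightarrow> (g ** transpose g) $ i $ j * m $ k + eps i j k) \<in> triangle_restrictions"
proof -
  obtain h where h: "g ** h = mat 1"
    using assms invertible_det_nz[of g] invertible_right_inverse[of g] by blast
  \<comment> \<open>Chosen so that \<open>g *v n = det g *s m\<close>: the factor
    \<open>det g\<close> cancels against the rescaling of the third factor and leaves
    \<open>m\<close>.\<close>
  define n where "n = det g *s (h *v m)"
  have n: "g *v n = det g *s m"
    unfolding n_def by (simp add: h matrix_vector_mul_assoc vector_scalar_commute)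
  have n1: "(\<Sum>p\<in>UNIV. g $ k $ p * n $ p) = det g * m $ k" for k
    using n by (simp add: vec_eq_iff matrix_vector_mult_def)
  let ?P = "\<chi> t. case t of (i, j, k) \<Rightarrow> (if i = j then n $ k else 0) + eps i j k"
  have "(g ** transpose g) $ i $ j * m $ k + eps i j k = act g g (\<chi> l. (1 / det g) *s g $ l) ?P $ (i, j, k)" for i j k
  proof -
    have "act g g (\<chi> l. (1 / det g) *s g $ l) ?P $ (i, j, k) = 1 / det g * tau ?P (g $ i) (g $ j) (g $ k)"
      by (simp add: tau_scale)
    also have "tau ?P a b c = (\<Sum>p\<in>UNIV. a $ p * b $ p) * (\<Sum>p\<in>UNIV. c $ p * n $ p) + det (vector [a, b, c])" for a b c
      by (simp add: tau_expand det_3 sum_3 algebra_simps)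
    also have "det (vector [g $ i, g $ j, g $ k] :: complex^3^3) = det g * eps i j k"
      using exhaust_3[of i] exhaust_3[of j] exhaust_3[of k]
      by (elim disjE) (simp_all add: det_3 algebra_simps)
    finally have *: "act g g (\<chi> l. (1 / det g) *s g $ l) ?P $ (i, j, k) =
      1 / det g * ((\<Sum>p\<in>UNIV. g $ i $ p * g $ j $ p) * (det g * m $ k) + det g * eps i j k)"
      unfolding n1 .
    show ?thesis unfolding * using assms
      by (simp add: matrix_matrix_mult_def transpose_def distrib_left)
  qed
  then have eq: "(\<chi> t. case t of (i, j, k) \<Rightarrow> (g ** transpose g) $ i $ j * m $ k + eps i j k) = act g g (\<chi> l. (1 / det g) *s g $ l) ?P"
    by (auto simp: vec_eq_iff)
  show ?thesis unfolding eq by (rule act_triangle_restrictions[OF pauli_restriction])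
qed

lemma symmetric_nth: "transpose Q = Q \<Longrightarrow> Q $ i $ j = Q $ j $ i"
  by (metis (mono_tags) transpose_def vec_lambda_beta)

text \<open>Cholesky factorisation with transpose instead of adjoint: complex square roots always
  exist, so only vanishing pivots can obstruct it. The divisors are the first two pivots; the third
  one, \<open>r\<close>, may be zero.\<close>

lemma cholesky_3:
  fixes Q :: "complex^3^3"
  assumes sym: "transpose Q = Q"
    and m1: "Q$1$1 \<noteq> 0" and m2: "Q$1$1 * Q$2$2 - Q$1$2 * Q$1$2 \<noteq> 0"
  shows "\<exists>g :: complex^3^3. g ** transpose g = Q"
proof -
  have s: "Q$2$1 = Q$1$2" "Q$3$1 = Q$1$3" "Q$3$2 = Q$2$3"
    using symmetric_nth[OF sym] by auto
  define x where "x = csqrt (Q$1$1)"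
  have x: "x^2 = Q$1$1" "x \<noteq> 0" using m1 by (auto simp: x_def)
  define y where "y = Q$1$2 / x"
  define p where "p = Q$1$3 / x"
  define z where "z = csqrt (Q$2$2 - y^2)"
  have z2: "z^2 = Q$2$2 - y^2" by (simp add: z_def)
  have xy: "x * y = Q$1$2" using x(2) by (simp add: y_def)
  have "x^2 * z^2 = x^2 * Q$2$2 - (x * y)^2"
    unfolding z2 by (simp add: power_mult_distrib algebra_simps)
  also have "\<dots> = Q$1$1 * Q$2$2 - Q$1$2 * Q$1$2"
    unfolding x(1) xy by (simp add: power2_eq_square)
  finally have "x^2 * z^2 = Q$1$1 * Q$2$2 - Q$1$2 * Q$1$2" .
  then have z: "z \<noteq> 0" using m2 by auto
  define q where "q = (Q$2$3 - y * p) / z"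
  define r where "r = csqrt (Q$3$3 - p^2 - q^2)"
  have r2: "r^2 = Q$3$3 - p^2 - q^2" by (simp add: r_def)
  define g :: "complex^3^3" where "g = vector [vector [x, 0, 0], vector [y, z, 0], vector [p, q, r]]"
  have "x * y = Q$1$2" "x * p = Q$1$3" "y * p + z * q = Q$2$3"
    using x(2) z by (auto simp: y_def p_def q_def)
  then have "g ** transpose g = Q"
    using x z2 r2
    by (simp add: vec_eq_iff forall_3 g_def matrix_matrix_mult_def transpose_def sum_3 s power2_eq_square
        mult.commute)
  then show ?thesis by blast
qed

lemma symmetric_closure:
  fixes Q :: "complex^3^3"
  assumes sym: "transpose Q = Q"
  shows "(\<chi> t. case t of (i, j, k) \<Rightarrow> Q $ i $ j * m $ k + eps i j k) \<in> closure triangle_restrictions"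
proof -
  have s: "Q$2$1 = Q$1$2" "Q$3$1 = Q$1$3" "Q$3$2 = Q$2$3"
    using symmetric_nth[OF sym] by auto
  \<comment> \<open>The leading principal minors of \<open>Q + t I\<close> as polynomials in
    \<open>t\<close>; they are monic of degrees 1, 2 and 3.\<close>
  define p1 where "p1 = [:Q$1$1, 1:]"
  define p2 where "p2 = [:Q$1$1, 1:] * [:Q$2$2, 1:] - [:(Q$1$2)^2:]"
  define p3 where "p3 = p2 * [:Q$3$3, 1:] - [:Q$2$3 * Q$2$3:] * [:Q$1$1, 1:]
     - [:Q$1$3 * Q$1$3:] * [:Q$2$2, 1:] + [:2 * Q$1$2 * Q$2$3 * Q$1$3:]"
  have nz: "p1 \<noteq> 0" "p2 \<noteq> 0" "p3 \<noteq> 0"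
  proof -
    have "coeff p1 1 = 1" "coeff p2 2 = 1" "coeff p3 3 = 1"
      by (simp_all add: p1_def p2_def p3_def numeral_2_eq_2 numeral_3_eq_3)
    then show "p1 \<noteq> 0" "p2 \<noteq> 0" "p3 \<noteq> 0" by auto
  qed
  define E where "E = {t. poly p1 t = 0} \<union> {t. poly p2 t = 0} \<union> {t. poly p3 t = 0}"
  have "finite E" unfolding E_def using nz by (simp add: poly_roots_finite)
  moreover have "(\<chi> t. case t of (i, j, k) \<Rightarrow> Q $ i $ j * m $ k + eps i j k) +
      t *s (\<chi> t. case t of (i, j, k) \<Rightarrow> mat 1 $ i $ j * m $ k) \<in> closure triangle_restrictions" if t: "t \<notin> E" for t
  proof -
    define Q' where "Q' = (\<chi> i j. Q $ i $ j + (if i = j then t else 0))"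
    have Q': "Q'$i$j = Q$i$j + (if i = j then t else 0)" for i j by (simp add: Q'_def)
    have "transpose Q' = Q'" using s by (simp add: vec_eq_iff transpose_def Q' forall_3)
    moreover have "Q'$1$1 = poly p1 t" "Q'$1$1 * Q'$2$2 - Q'$1$2 * Q'$1$2 = poly p2 t"
      by (simp_all add: p1_def p2_def Q' algebra_simps power2_eq_square)
    moreover have d: "det Q' = poly p3 t"
      by (simp add: p3_def p2_def Q' det_3 s algebra_simps power2_eq_square)
    ultimately obtain g :: "complex^3^3" where g: "g ** transpose g = Q'"
      using cholesky_3[of Q'] t unfolding E_def by auto
    have "det g * det g = det Q'" using g by (metis det_mul det_transpose)
    then have "det g \<noteq> 0" using d t by (auto simp: E_def)
    from gram_restriction[OF this, of m]
    have "(\<chi> t. case t of (i, j, k) \<Rightarrow> Q' $ i $ j * m $ k + eps i j k) \<in> triangle_restrictions"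
      by (simp add: g)
    also have "(\<chi> t. case t of (i, j, k) \<Rightarrow> Q' $ i $ j * m $ k + eps i j k) =
       (\<chi> t. case t of (i, j, k) \<Rightarrow> Q $ i $ j * m $ k + eps i j k) +
      t *s (\<chi> t. case t of (i, j, k) \<Rightarrow> mat 1 $ i $ j * m $ k)"
      by (auto simp: vec_eq_iff Q' mat_def algebra_simps)
    finally show ?thesis using closure_subset by blast
  qed
  ultimately show ?thesis using closed_perturb[OF closed_closure] by blast
qed

text \<open>After rescaling the third factor, \<open>T\<close> is \<open>det + Q \<otimes> e\<^sub>1\<close> up to shifts of \<open>b\<^sub>1\<close> and \<open>c\<^sub>1\<close>; the entries
  with one index different from \<open>1\<close> determine the shifts and the off-diagonal part of \<open>Q\<close>.\<close>

lemma normalized_block_closure_aux: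
  assumes z: "\<And>i j k. i \<noteq> 1 \<Longrightarrow> j \<noteq> 1 \<Longrightarrow> k \<noteq> 1 \<Longrightarrow> T $ (i, j, k) = 0"
    and X: "T$(1,2,2) = 0" "T$(1,2,3) = 1" "T$(1,3,2) = -1" "T$(1,3,3) = 0"
    and Y: "T$(2,1,2) = 0" "T$(2,1,3) = -1" "T$(3,1,2) = 1" "T$(3,1,3) = 0"
    and \<sigma>: "T$(2,3,1) \<noteq> T$(3,2,1)"
  shows "T \<in> closure triangle_restrictions"
proof -
  \<comment> \<open>The entries (2,3,1) and (3,2,1) of the target are \<open>q23 + \<sigma>\<close>
    and \<open>q23 - \<sigma>\<close>: \<open>\<sigma>\<close> is the scale of the third factor and
    multiplies the antisymmetric part.\<close>
  define \<sigma> where "\<sigma> = (T$(2,3,1) - T$(3,2,1)) / 2"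
  have \<sigma>0: "\<sigma> \<noteq> 0" using \<sigma> by (simp add: \<sigma>_def)
  define n2 n3 where "n2 = T$(1,1,3)" and "n3 = - T$(1,1,2)"
  \<comment> \<open>Subtracting the effect of the shift of the first vector of the second factor
    leaves \<open>q12 - k3\<close> and \<open>q13 + k2\<close>. The entries (1,2,1) and (1,3,1) are
    \<open>q12 + k3\<close> and \<open>q13 - k2\<close>, so half sums and half differences give the
    four unknowns.\<close>
  define w2 w3 where "w2 = T$(2,1,1) - n2 * T$(2,2,1) - n3 * T$(2,3,1)"
    and "w3 = T$(3,1,1) - n2 * T$(3,2,1) - n3 * T$(3,3,1)"
  define k2 k3 where "k2 = (w3 - T$(1,3,1)) / 2" and "k3 = (T$(1,2,1) - w2) / 2"
  define q12 q13 where "q12 = (T$(1,2,1) + w2) / 2" and "q13 = (T$(1,3,1) + w3) / 2"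
  define q11 where "q11 = T$(1,1,1) - n2 * T$(1,2,1) - n3 * T$(1,3,1)"
  define q23 where "q23 = (T$(2,3,1) + T$(3,2,1)) / 2"
  define Q :: "complex^3^3" where "Q = (\<chi> i j. (1 / \<sigma>) * vector [vector [q11, q12, q13] :: complex^3,
    vector [q12, T$(2,2,1), q23], vector [q13, q23, T$(3,3,1)]] $ i $ j)"
  let ?S = "\<chi> t. case t of (i, j, k) \<Rightarrow> Q $ i $ j * axis 1 1 $ k + eps i j k"
  have "transpose Q = Q" by (simp add: vec_eq_iff forall_3 transpose_def Q_def)
  then have S: "?S \<in> closure triangle_restrictions" by (rule symmetric_closure)
  have T: "T = act (mat 1) (vector [vector [1, n2, n3], axis 2 1, axis 3 1])
     (vector [vector [\<sigma>, k2, k3], axis 2 1, axis 3 1]) ?S"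
  proof -
    have ax: "(mat 1 :: complex^3^3) $ i = axis i 1" for i by (simp add: vec_eq_iff mat_def axis_def)
    have tS: "tau ?S a b c = c $ 1 * (\<Sum>i\<in>UNIV. \<Sum>j\<in>UNIV. Q $ i $ j * a $ i * b $ j) + det (vector [a, b, c])" for a b c
      by (simp add: tau_expand det_3 sum_3 axis_def algebra_simps)
    have Q: "q11 = \<sigma> * Q$1$1" "q12 = \<sigma> * Q$1$2" "q13 = \<sigma> * Q$1$3" "q23 = \<sigma> * Q$2$3"
      "T$(2,2,1) = \<sigma> * Q$2$2" "T$(3,3,1) = \<sigma> * Q$3$3"
      "Q$2$1 = Q$1$2" "Q$3$1 = Q$1$3" "Q$3$2 = Q$2$3"
      using \<sigma>0 by (simp_all add: Q_def)
    have t: "T$(2,3,1) = q23 + \<sigma>" "T$(3,2,1) = q23 - \<sigma>"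
      by (simp_all add: q23_def \<sigma>_def field_simps)
    have u: "T$(1,1,2) = - n3" "T$(1,1,3) = n2" by (simp_all add: n2_def n3_def)
    have v: "T$(1,2,1) = q12 + k3" "T$(1,3,1) = q13 - k2" by (simp_all add: q12_def q13_def k2_def k3_def field_simps)
    have w: "T$(2,1,1) = q12 - k3 + n2 * T$(2,2,1) + n3 * T$(2,3,1)"
      "T$(3,1,1) = q13 + k2 + n2 * T$(3,2,1) + n3 * T$(3,3,1)" by (simp_all add: q12_def q13_def k2_def k3_def w2_def w3_def field_simps)
    have q: "T$(1,1,1) = q11 + n2 * T$(1,2,1) + n3 * T$(1,3,1)" by (simp add: q11_def)
    note c = q[unfolded v Q] w[unfolded t Q] t[unfolded Q] u v[unfolded Q] Q(5,6)
    show ?thesis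
      unfolding vec_eq_iff[of T] split_paired_All forall_3 act_nth tS ax
      by (simp add: sum_3 det_3 axis_def z X Y c Q(7-9)) (simp add: algebra_simps)
  qed
  show ?thesis by (subst T) (rule act_closure[OF S])
qed

text \<open>Moving the entry (2,3,1) alone respects the vanishing block and both normalised blocks,
  and it separates that entry from (3,2,1) for all but one parameter.\<close>

lemma normalized_block_closure:
  assumes z: "\<And>i j k. i \<noteq> 1 \<Longrightarrow> j \<noteq> 1 \<Longrightarrow> k \<noteq> 1 \<Longrightarrow> T $ (i, j, k) = 0"
    and X: "T$(1,2,2) = 0" "T$(1,2,3) = 1" "T$(1,3,2) = -1" "T$(1,3,3) = 0"
    and Y: "T$(2,1,2) = 0" "T$(2,1,3) = -1" "T$(3,1,2) = 1" "T$(3,1,3) = 0"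
  shows "T \<in> closure triangle_restrictions"
proof (rule closed_perturb[of "closure triangle_restrictions" "{T$(3,2,1) - T$(2,3,1)}" T "axis (2,3,1) 1"])
  fix t assume t: "t \<notin> {T$(3,2,1) - T$(2,3,1)}"
  show "T + t *s axis (2,3,1) 1 \<in> closure triangle_restrictions"
    by (rule normalized_block_closure_aux) (use t z X Y in \<open>auto simp: axis_def eq_diff_eq add.commute\<close>)
qed auto

text \<open>The hypotheses say that the blocks T(1,j,k) and T(j,1,k), with j and k in {2,3}, are
  invertible. \<open>H\<close> brings the first to the corresponding block of \<open>eps\<close> and
  \<open>G\<close> the second. Both fix the first basis vector, so the two normalisations do not
  disturb each other.\<close>

lemma generic_block_closure:
  assumes z: "\<And>i j k. i \<noteq> 1 \<Longrightarrow> j \<noteq> 1 \<Longrightarrow> k \<noteq> 1 \<Longrightarrow> T $ (i, j, k) = 0"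
    and X: "T$(1,2,2) * T$(1,3,3) - T$(1,2,3) * T$(1,3,2) \<noteq> 0"
    and Y: "T$(2,1,2) * T$(3,1,3) - T$(2,1,3) * T$(3,1,2) \<noteq> 0"
  shows "T \<in> closure triangle_restrictions"
proof -
  obtain x y where x: "T$(1,2,2) * T$(1,3,3) = x + T$(1,2,3) * T$(1,3,2)" "x \<noteq> 0"
    and y: "T$(2,1,2) * T$(3,1,3) = y + T$(2,1,3) * T$(3,1,2)" "y \<noteq> 0"
    using X Y by (metis diff_add_cancel)
  define G :: "complex^3^3" where "G = vector [axis 1 1, vector [0, T$(3,1,2) / y, - T$(2,1,2) / y],
     vector [0, T$(3,1,3) / y, - T$(2,1,3) / y]]"
  define H :: "complex^3^3" where "H = vector [axis 1 1, vector [0, - T$(1,3,2) / x, T$(1,2,2) / x],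
     vector [0, - T$(1,3,3) / x, T$(1,2,3) / x]]"
  have "det G = 1 / y" "det H = 1 / x"
    unfolding G_def H_def using x y by (simp_all add: det_3 axis_def field_simps power2_eq_square)
  then have "invertible G" "invertible H" using x(2) y(2) by (simp_all add: invertible_det_nz)
  moreover have "act G H (mat 1) T \<in> closure triangle_restrictions"
  proof (rule normalized_block_closure)
    show "act G H (mat 1) T $ (i, j, k) = 0" if "i \<noteq> 1" "j \<noteq> 1" "k \<noteq> 1" for i j k
      using that exhaust_3[of i] exhaust_3[of j] exhaust_3[of k]
      by (auto simp: tau_expand G_def H_def mat_def axis_def z)
  qed (use x y in \<open>simp_all add: tau_expand G_def H_def mat_def axis_def field_simps\<close>)
  ultimately show ?thesis
    by (metis closure_actI invertible_def matrix_mul_lid)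
qed

lemma zero_block_closure:
  assumes "zero_block T"
  shows "T \<in> closure triangle_restrictions"
proof -
  obtain G H L where inv: "invertible G" "invertible H" "invertible L" and
    z: "\<And>i j k. i \<noteq> 1 \<Longrightarrow> j \<noteq> 1 \<Longrightarrow> k \<noteq> 1 \<Longrightarrow> act G H L T $ (i, j, k) = 0"
    using zero_block_normalize[OF assms] by blast
  define S where "S = act G H L T"
  define p where "p = [:S$(1,2,2), 1:] * [:S$(1,3,3), 1:] - [:S$(1,2,3) * S$(1,3,2):]"
  define q where "q = [:S$(2,1,2), 1:] * [:S$(3,1,3), 1:] - [:S$(2,1,3) * S$(3,1,2):]"
  have "coeff p 2 = 1" "coeff q 2 = 1" by (simp_all add: p_def q_def numeral_2_eq_2)
  then have nz: "p \<noteq> 0" "q \<noteq> 0" by auto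
  \<comment> \<open>Adds \<open>t\<close> times the identity to the two blocks that must be
    invertible and leaves the vanishing block alone; \<open>p\<close> and \<open>q\<close> are the
    resulting determinants, monic of degree 2.\<close>
  define R :: "complex^(3 \<times> 3 \<times> 3)" where "R = axis (1,2,2) 1 + axis (1,3,3) 1 + axis (2,1,2) 1 + axis (3,1,3) 1"
  have "S \<in> closure triangle_restrictions"
  proof (rule closed_perturb[of "closure triangle_restrictions" "{t. poly p t = 0} \<union> {t. poly q t = 0}" S R])
    fix t assume t: "t \<notin> {t. poly p t = 0} \<union> {t. poly q t = 0}"
    show "S + t *s R \<in> closure triangle_restrictions"
      by (rule generic_block_closure)
        (use t z in \<open>auto simp: R_def axis_def p_def q_def algebra_simps S_def[symmetric]\<close>)
  qed (use nz in \<open>simp_all add: poly_roots_finite\<close>)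
  then show ?thesis using inv closure_actI unfolding S_def by blast
qed

section \<open>Tensors whose slices are singular on planes\<close>

lemma poly_root_exists:
  fixes p :: "complex poly"
  assumes "degree p \<noteq> 0"
  shows "\<exists>z. poly p z = 0"
  by (rule fundamental_theorem_of_algebra) (simp add: constant_degree assms)

lemma binary_quadratic_zero:
  "\<exists>s t :: complex. (s \<noteq> 0 \<or> t \<noteq> 0) \<and> e * s^2 + f * s * t + g * t^2 = 0"
proof (cases "e = 0")
  case True
  then show ?thesis by (intro exI[of _ 1] exI[of _ 0]) auto
next
  case False
  then obtain z where "poly [:g, f, e:] z = 0" using poly_root_exists[of "[:g, f, e:]"] by auto
  then show ?thesis by (intro exI[of _ z] exI[of _ 1]) (auto simp: algebra_simps power2_eq_square)
qed

lemma binary_cubic_zero: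
  "\<exists>s t :: complex. (s \<noteq> 0 \<or> t \<noteq> 0) \<and> e * s^3 + f * s^2 * t + g * s * t^2 + h * t^3 = 0"
proof (cases "e = 0")
  case True
  then show ?thesis by (intro exI[of _ 1] exI[of _ 0]) auto
next
  case False
  then obtain z where "poly [:h, g, f, e:] z = 0" using poly_root_exists[of "[:h, g, f, e:]"] by auto
  then show ?thesis
    by (intro exI[of _ z] exI[of _ 1]) (auto simp: algebra_simps power2_eq_square power3_eq_cube)
qed

section \<open>Linear forms and independent vectors in their kernels\<close>

definition dot :: "complex^3 \<Rightarrow> complex^3 \<Rightarrow> complex" where
  "dot p u = (\<Sum>i\<in>UNIV. p $ i * u $ i)"

lemma dot_expand: "dot p u = p$1 * u$1 + p$2 * u$2 + p$3 * u$3"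
  by (simp add: dot_def sum_3)

lemma tau_dot:
  "tau T a b c = dot (\<chi> i. tau T (axis i 1) b c) a"
  "tau T a b c = dot (\<chi> i. tau T a (axis i 1) c) b"
  "tau T a b c = dot (\<chi> i. tau T a b (axis i 1)) c"
  by (simp_all add: tau_expand dot_expand axis_def algebra_simps)

lemma indepI: "(\<And>s t. s *s u + t *s v = 0 \<Longrightarrow> s = 0 \<and> t = 0) \<Longrightarrow> indep u v"
  by (simp add: indep_def)

lemma indepD: "indep u v \<Longrightarrow> s *s u + t *s v = 0 \<Longrightarrow> s = 0 \<and> t = 0"
  by (simp add: indep_def)

lemma dot_kernel: "\<exists>u v. indep u v \<and> dot p u = 0 \<and> dot p v = 0"
proof -
  have "\<exists>u v. indep u v \<and> dot p u = 0 \<and> dot p v = 0" if "p$1 \<noteq> 0"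
    by (rule exI[of _ "vector [- p$2, p$1, 0]"], rule exI[of _ "vector [- p$3, 0, p$1]"])
       (use that in \<open>auto simp: indep_def vec_eq_iff forall_3 dot_expand\<close>)
  moreover have "\<exists>u v. indep u v \<and> dot p u = 0 \<and> dot p v = 0" if "p$1 = 0" "p$2 \<noteq> 0"
    by (rule exI[of _ "vector [1, 0, 0]"], rule exI[of _ "vector [0, - p$3, p$2]"])
       (use that in \<open>auto simp: indep_def vec_eq_iff forall_3 dot_expand\<close>)
  moreover have "\<exists>u v. indep u v \<and> dot p u = 0 \<and> dot p v = 0" if "p$1 = 0" "p$2 = 0"
    by (rule exI[of _ "vector [1, 0, 0]"], rule exI[of _ "vector [0, 1, 0]"])
       (use that in \<open>auto simp: indep_def vec_eq_iff forall_3 dot_expand\<close>)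
  ultimately show ?thesis by blast
qed

lemma dot_kernel_2: "\<exists>u. u \<noteq> 0 \<and> dot p u = 0 \<and> dot q u = 0"
proof -
  have "det (vector [p, q, 0] :: complex^3^3) = 0" by (simp add: det_3)
  then obtain u where "u \<noteq> 0" "(vector [p, q, 0] :: complex^3^3) *v u = 0" using det_0_iff_ker by blast
  then show ?thesis
    by (intro exI[of _ u]) (auto simp: vec_eq_iff forall_3 matrix_vector_mult_def dot_expand sum_3)
qed

lemma not_indepD: "\<not> indep a u \<Longrightarrow> a \<noteq> 0 \<Longrightarrow> \<exists>r. u = r *s a"
proof -
  assume "\<not> indep a u" "a \<noteq> 0"
  then obtain s t where st: "s *s a + t *s u = 0" "s \<noteq> 0 \<or> t \<noteq> 0" by (auto simp: indep_def)
  with \<open>a \<noteq> 0\<close> have t: "t \<noteq> 0" by (auto simp: vec_eq_iff)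
  have "u $ i = - (s / t) * a $ i" for i
  proof -
    have "s * a $ i + t * u $ i = 0" using st(1) by (simp add: vec_eq_iff)
    then show ?thesis using t by (simp add: field_simps add_eq_0_iff)
  qed
  then show ?thesis by (intro exI[of _ "- (s / t)"]) (simp add: vec_eq_iff)
qed

text \<open>The kernel of a linear form has dimension at least two, so it is not contained in the
  line through \<open>a\<close>.\<close>

lemma indep_in_kernel:
  assumes "a \<noteq> 0"
  shows "\<exists>u. indep a u \<and> dot p u = 0"
proof (rule ccontr)
  assume *: "\<not> ?thesis"
  obtain u v where uv: "indep u v" "dot p u = 0" "dot p v = 0" using dot_kernel by blast
  then obtain r s where r: "u = r *s a" "v = s *s a" using * not_indepD assms by metis
  then have "s *s u + (- r) *s v = 0" by (simp add: vec_eq_iff)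
  from indepD[OF uv(1) this] have "r = 0" "s = 0" by auto
  then have "1 *s u + 0 *s v = 0" using r by (simp add: vec_eq_iff)
  then show False using uv(1) unfolding indep_def by (metis zero_neq_one)
qed

lemma dot_add: "dot p (u + v) = dot p u + dot p v" and dot_scale: "dot p (s *s u) = s * dot p u"
  by (simp_all add: dot_expand algebra_simps)

lemma indep_outside_kernel:
  assumes "dot p a \<noteq> 0" "dot p u = 0" "u \<noteq> 0"
  shows "indep a u"
proof (rule indepI)
  fix s t assume *: "s *s a + t *s u = 0"
  then have "s * dot p a + t * dot p u = 0" by (metis dot_add dot_scale mult_zero_left vector_smult_lzero)
  then have "s = 0" using assms by auto
  with * assms(3) show "s = 0 \<and> t = 0" by (auto simp: vec_eq_iff)
qed

lemma indep_scale_nonzero: "indep u v \<Longrightarrow> s \<noteq> 0 \<or> t \<noteq> 0 \<Longrightarrow> s *s u + t *s v \<noteq> 0"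
  by (auto simp: indep_def)

text \<open>Two bilinear forms on \<open>\<complex>\<^sup>2 \<times> \<complex>\<^sup>2\<close> have a common zero because two curves of bidegree
  \<open>(1, 1)\<close> on \<open>\<P>\<^sup>1 \<times> \<P>\<^sup>1\<close> meet.\<close>

lemma bilinear_forms_common_zero:
  fixes g11 :: complex
  shows "\<exists>s t x y. (s \<noteq> 0 \<or> t \<noteq> 0) \<and> (x \<noteq> 0 \<or> y \<noteq> 0) \<and>
    s * (x * g11 + y * g12) + t * (x * g21 + y * g22) = 0 \<and>
    s * (x * h11 + y * h12) + t * (x * h21 + y * h22) = 0"
proof -
  \<comment> \<open>For fixed (s, t) the conditions are two linear equations in (x, y). The
    quadratic form is their determinant, so a zero of it leaves a nontrivial solution.\<close>
  obtain s t where st: "s \<noteq> 0 \<or> t \<noteq> 0" and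
    q: "(g11 * h12 - g12 * h11) * s^2 + (g11 * h22 + g21 * h12 - g12 * h21 - g22 * h11) * s * t
      + (g21 * h22 - g22 * h21) * t^2 = 0"
    using binary_quadratic_zero by blast
  define a b c d where "a = s * g11 + t * g21" and "b = s * g12 + t * g22"
    and "c = s * h11 + t * h21" and "d = s * h12 + t * h22"
  have "a * d - b * c = 0"
    using q by (simp add: a_def b_def c_def d_def power2_eq_square algebra_simps)
  then have "\<exists>x y. (x \<noteq> 0 \<or> y \<noteq> 0) \<and> a * x + b * y = 0 \<and> c * x + d * y = 0"
  proof (cases "a = 0 \<and> b = 0")
    case True
    show ?thesis
    proof (cases "c = 0 \<and> d = 0")
      case True
      with \<open>a = 0 \<and> b = 0\<close> show ?thesis by (intro exI[of _ 1]) auto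
    next
      case False
      with True show ?thesis by (intro exI[of _ d] exI[of _ "- c"]) auto
    qed
  next
    case False
    then show ?thesis using \<open>a * d - b * c = 0\<close>
      by (intro exI[of _ b] exI[of _ "- a"]) (auto simp: algebra_simps)
  qed
  then obtain x y where "x \<noteq> 0 \<or> y \<noteq> 0" "a * x + b * y = 0" "c * x + d * y = 0" by blast
  with st show ?thesis
    by (intro exI[of _ s] exI[of _ t] exI[of _ x] exI[of _ y])
       (auto simp: a_def b_def c_def d_def algebra_simps)
qed

text \<open>If the form at \<open>a0\<close>, \<open>b0\<close> is zero in the third argument,
  complete \<open>a0\<close> and \<open>b0\<close> by vectors of the kernels of \<alpha> and
  \<beta>: only one linear form in the third argument remains, and its kernel contains a plane.
  Otherwise \<gamma> and \<gamma>' are nonzero multiples of each other, so both rank-one slices die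
  on the kernel of \<gamma>. What is left is a pair of bilinear forms on the kernels of \<alpha> and
  \<beta>, and these have a common zero.\<close>

lemma rank_one_slices_zero_block:
  assumes a0: "a0 \<noteq> 0" "\<And>b c. tau T a0 b c = dot \<beta> b * dot \<gamma> c"
    and b0: "b0 \<noteq> 0" "\<And>a c. tau T a b0 c = dot \<alpha> a * dot \<gamma>' c"
  shows "zero_block T"
proof (cases "(\<forall>c. dot \<gamma> c = 0) \<or> dot \<beta> b0 = 0")
  case True
  obtain b1 where b1: "indep b0 b1" "dot \<beta> b1 = 0" using indep_in_kernel b0(1) by blast
  obtain a1 where a1: "indep a0 a1" "dot \<alpha> a1 = 0" using indep_in_kernel a0(1) by blast
  obtain c c' where c: "indep c c'" "tau T a1 b1 c = 0" "tau T a1 b1 c' = 0"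
    using dot_kernel tau_dot(3)[of T a1 b1] by metis
  have t: "tau T a0 b0 z = 0" "tau T a0 b1 z = 0" "tau T a1 b0 z = 0" for z
    using True a0(2) a1(2) b0(2) b1(2) by (metis mult_eq_0_iff)+
  have "tau T x y z = 0" if "x \<in> {a0, a1}" "y \<in> {b0, b1}" "z \<in> {c, c'}" for x y z
    using that t c by auto
  then show ?thesis unfolding zero_block_def using a1 b1 c by blast
next
  case False
  then obtain c0 where c0: "dot \<gamma> c0 \<noteq> 0" and bb: "dot \<beta> b0 \<noteq> 0" by blast
  have e: "dot \<beta> b0 * dot \<gamma> c = dot \<alpha> a0 * dot \<gamma>' c" for c using a0(2) b0(2) by metis
  with c0 bb have aa: "dot \<alpha> a0 \<noteq> 0" by (metis mult_eq_0_iff)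
  obtain a2 a3 where a: "indep a2 a3" "dot \<alpha> a2 = 0" "dot \<alpha> a3 = 0" using dot_kernel by blast
  obtain b2 b3 where b: "indep b2 b3" "dot \<beta> b2 = 0" "dot \<beta> b3 = 0" using dot_kernel by blast
  obtain c1 c2 where c: "indep c1 c2" "dot \<gamma> c1 = 0" "dot \<gamma> c2 = 0" using dot_kernel by blast
  obtain s t x y where st: "s \<noteq> 0 \<or> t \<noteq> 0" and xy: "x \<noteq> 0 \<or> y \<noteq> 0" and
    z: "s * (x * tau T a2 b2 c1 + y * tau T a2 b3 c1) + t * (x * tau T a3 b2 c1 + y * tau T a3 b3 c1) = 0"
      "s * (x * tau T a2 b2 c2 + y * tau T a2 b3 c2) + t * (x * tau T a3 b2 c2 + y * tau T a3 b3 c2) = 0"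
    using bilinear_forms_common_zero by metis
  define a' b' where "a' = s *s a2 + t *s a3" and "b' = x *s b2 + y *s b3"
  have "a' \<noteq> 0" "b' \<noteq> 0" unfolding a'_def b'_def using st xy a b indep_scale_nonzero by blast+
  moreover have ab: "dot \<alpha> a' = 0" "dot \<beta> b' = 0" using a b by (simp_all add: a'_def b'_def dot_add dot_scale)
  ultimately have "indep a0 a'" "indep b0 b'" using aa bb indep_outside_kernel by blast+
  moreover have g: "dot \<gamma>' c1 = 0" "dot \<gamma>' c2 = 0" using e[of c1] e[of c2] aa c by auto
  moreover have "tau T a' b' c1 = 0" "tau T a' b' c2 = 0"
    unfolding a'_def b'_def tau_add tau_scale using z by (simp_all add: algebra_simps)
  then have "tau T u v w = 0" if "u \<in> {a0, a'}" "v \<in> {b0, b'}" "w \<in> {c1, c2}" for u v w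
    using that a0(2) b0(2) ab c g by auto
  ultimately show ?thesis unfolding zero_block_def using c by blast
qed

section \<open>Singular pencils of 3 x 3 matrices\<close>

lemma indep_image:
  assumes "det A \<noteq> 0" "indep u v"
  shows "indep (A *v u) (A *v v)"
proof (rule indepI)
  fix s t assume "s *s (A *v u) + t *s (A *v v) = 0"
  then have "A *v (s *s u + t *s v) = 0"
    by (simp add: matrix_vector_right_distrib vector_scalar_commute)
  then show "s = 0 \<and> t = 0" using assms det_0_iff_ker unfolding indep_def by blast
qed

lemma invertible_vector_3_span:
  assumes "invertible (vector [u, v, w] :: complex^3^3)"
  shows "\<exists>r s t. x = r *s u + s *s v + t *s w"
proof -
  have "invertible (transpose (vector [u, v, w] :: complex^3^3))" using assms by (simp add: invertible_det_nz)
  then obtain B where "transpose (vector [u, v, w] :: complex^3^3) ** B = mat 1"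
    unfolding invertible_right_inverse by blast
  then have "x = transpose (vector [u, v, w] :: complex^3^3) *v (B *v x)"
    by (simp only: matrix_vector_mul_assoc matrix_vector_mul_lid)
  moreover have "transpose (vector [u, v, w] :: complex^3^3) *v y = y $ 1 *s u + y $ 2 *s v + y $ 3 *s w" for y
    by (simp add: vec_eq_iff vector_matrix_mult_def sum_3 mult.commute)
  ultimately show ?thesis by metis
qed

lemma dot_transpose: "dot (transpose P *v b) c = dot b (P *v c)"
  by (simp add: dot_expand matrix_vector_mult_def transpose_def sum_3 algebra_simps)

text \<open>The hypotheses say that \<open>M\<close> has rank exactly two. The columns of
  \<open>Q\<close> are a basis starting with the kernel vector \<open>k\<close>, and
  \<open>P\<close> sends the images of the other two to the second and third unit vectors.\<close>

lemma singular_3_normal_form: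
  fixes M :: "complex^3^3"
  assumes "det M = 0" and "\<nexists>u v. indep u v \<and> M *v u = 0 \<and> M *v v = 0"
  obtains P Q where "det P \<noteq> 0" "det Q \<noteq> 0"
    "P ** M ** Q = (\<chi> i j. if i = j \<and> i \<noteq> 1 then 1 else 0)"
proof -
  obtain k where k: "k \<noteq> 0" "M *v k = 0" using assms(1) det_0_iff_ker by blast
  obtain u where "indep k u" using indep_in_kernel k(1) by blast
  then obtain w where "invertible (vector [w, k, u] :: complex^3^3)" using indep_extend by blast
  then have wku: "r = 0 \<and> s = 0 \<and> t = 0" if "r *s w + s *s k + t *s u = 0" for r s t
    using that invertible_vector_3_iff by blast
  have "indep (M *v w) (M *v u)"
  proof (rule indepI)
    fix r t assume "r *s (M *v w) + t *s (M *v u) = 0"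
    then have z: "M *v (r *s w + t *s u) = 0"
      by (simp add: matrix_vector_right_distrib vector_scalar_commute)
    then have "\<not> indep k (r *s w + t *s u)" using assms(2) k by blast
    then obtain q where "r *s w + t *s u = q *s k" using not_indepD k by blast
    then have "r *s w + (- q) *s k + t *s u = 0" by (simp add: vec_eq_iff algebra_simps)
    from wku[OF this] show "r = 0 \<and> t = 0" by blast
  qed
  then obtain z where z: "invertible (vector [z, M *v w, M *v u] :: complex^3^3)" (is "invertible ?Z")
    using indep_extend by blast
  then have "invertible (transpose ?Z)" by (simp add: invertible_det_nz)
  then obtain P where P: "P ** transpose ?Z = mat 1"
    unfolding invertible_left_inverse by blast
  define Q :: "complex^3^3" where "Q = transpose (vector [k, w, u])"
  have "invertible (vector [k, w, u] :: complex^3^3)"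
    unfolding invertible_vector_3_iff
  proof (intro allI impI)
    fix r s t assume "r *s k + s *s w + t *s u = 0"
    then have "s *s w + r *s k + t *s u = 0" by (simp add: add.commute[of "r *s k"])
    from wku[OF this] show "r = 0 \<and> s = 0 \<and> t = 0" by blast
  qed
  then have "det Q \<noteq> 0" by (simp add: Q_def invertible_det_nz)
  have "det P \<noteq> 0" using P by (metis det_I det_mul mult_zero_left zero_neq_one)
  have MQ: "M ** Q = transpose ?Z ** (\<chi> i j. if i = j \<and> i \<noteq> 1 then 1 else 0)"
  proof -
    have "(\<Sum>p\<in>UNIV. M $ i $ p * k $ p) = 0" for i using k(2) by (simp add: vec_eq_iff matrix_vector_mult_def)
    then show ?thesis
      by (simp add: vec_eq_iff forall_3 matrix_matrix_mult_def transpose_def Q_def sum_3 matrix_vector_mult_def)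
  qed
  have "P ** M ** Q = (\<chi> i j. if i = j \<and> i \<noteq> 1 then 1 else 0)"
  proof -
    have "P ** M ** Q = P ** (M ** Q)" by (simp only: matrix_mul_assoc)
  also have "\<dots> = (P ** transpose ?Z) ** (\<chi> i j. if i = j \<and> i \<noteq> 1 then 1 else 0)"
    unfolding MQ by (simp only: matrix_mul_assoc)
  finally show ?thesis
    unfolding P by simp
  qed
  then show thesis using that \<open>det P \<noteq> 0\<close> \<open>det Q \<noteq> 0\<close> by blast
qed

lemma det_nonzero_ker: "det A \<noteq> 0 \<Longrightarrow> A *v y = 0 \<longleftrightarrow> y = 0"
  for A :: "complex^'n^'n"
  by (metis det_0_iff_ker matrix_vector_mult_0_right)

text \<open>With D = diag(0, 1, 1), the coefficients of det (D + t E) give e11 = 0, v . u = 0 and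
  det E = 0, where u and v are the rests of the first column and the first row of E. If u = 0 the
  pencil has a common kernel, if v = 0 a common left kernel. Otherwise the first unit vector with v,
  and the first unit vector with u, span the block.\<close>

lemma singular_pencil_3_aux:
  fixes M N P Q :: "complex^3^3"
  assumes sing: "\<And>s t. det (\<chi> i j. s * M $ i $ j + t * N $ i $ j) = 0"
    and inv: "det P \<noteq> 0" "det Q \<noteq> 0"
    and D: "P ** M ** Q = (\<chi> i j. if i = j \<and> i \<noteq> 1 then 1 else 0)"
  shows "(\<exists>c. c \<noteq> 0 \<and> M *v c = 0 \<and> N *v c = 0) \<or>
    (\<exists>b. b \<noteq> 0 \<and> transpose M *v b = 0 \<and> transpose N *v b = 0) \<or>
    (\<exists>b b' c c'. indep b b' \<and> indep c c' \<and>
      (\<forall>x\<in>{b, b'}. \<forall>y\<in>{c, c'}. dot x (M *v y) = 0 \<and> dot x (N *v y) = 0))"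
proof -
  define D where "D = P ** M ** Q"
  define E where "E = P ** N ** Q"
  have D_nth: "D $ i $ j = (if i = j \<and> i \<noteq> 1 then 1 else 0)" for i j by (simp add: D_def D)
  have MN: "Q *v y = 0 \<longleftrightarrow> y = 0" "transpose P *v y = 0 \<longleftrightarrow> y = 0"
    "P *v y = 0 \<longleftrightarrow> y = 0" "transpose Q *v y = 0 \<longleftrightarrow> y = 0" for y
    using inv by (simp_all only: det_nonzero_ker det_transpose simp_thms)
  have ev: "D *v y = P *v (M *v (Q *v y))" "E *v y = P *v (N *v (Q *v y))"
    "transpose D *v y = transpose Q *v (transpose M *v (transpose P *v y))"
    "transpose E *v y = transpose Q *v (transpose N *v (transpose P *v y))" for y
    by (simp_all only: D_def E_def matrix_transpose_mul matrix_vector_mul_assoc matrix_mul_assoc)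
  have det0: "det (\<chi> i j. D $ i $ j + t * E $ i $ j) = 0" for t
  proof -
    have "(\<chi> i j. D $ i $ j + t * E $ i $ j) = P ** (\<chi> i j. 1 * M $ i $ j + t * N $ i $ j) ** Q"
      by (simp add: vec_eq_iff D_def E_def matrix_matrix_mult_def sum_3 algebra_simps)
    then show ?thesis using sing[of 1 t] by (simp only: det_mul mult_zero_left mult_zero_right)
  qed
  define e where "e i j = E $ i $ j" for i j
  have p: "t * e 1 1 + t^2 * (e 1 1 * (e 2 2 + e 3 3) - e 1 2 * e 2 1 - e 1 3 * e 3 1) + t^3 * det E = 0" for t
    using det0[of t] by (simp add: det_3 D_nth e_def algebra_simps power2_eq_square power3_eq_cube)
  have c0: "a = 0 \<and> b = 0 \<and> c = 0" if "\<And>t. t * a + t^2 * b + t^3 * c = 0" for a b c :: complex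
  proof -
    have 1: "a + b + c = 0" "- a + b - c = 0" "2 * a + 4 * b + 8 * c = 0"
      using that[of 1] that[of "-1"] that[of 2] by simp_all
    have "2 * b = (a + b + c) + (- a + b - c)" by simp
    then have b: "b = 0" unfolding 1 by simp
    have "a = - c" using 1(1) b by (simp add: eq_neg_iff_add_eq_0)
    with 1(3) b show ?thesis by simp
  qed
  have e11: "e 1 1 = 0" and r: "e 1 2 * e 2 1 + e 1 3 * e 3 1 = 0" and d: "det E = 0"
    using c0[OF p] by (auto simp: algebra_simps)
  have r': "e 1 3 * e 3 1 = - (e 1 2 * e 2 1)" using r by (simp add: add_eq_0_iff)
  have "e 1 2 * e 2 3 * e 3 1 + e 1 3 * e 2 1 * e 3 2 - e 1 2 * e 2 1 * e 3 3 - e 1 3 * e 3 1 * e 2 2 = 0"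
    using d e11 by (simp add: det_3 e_def[symmetric] algebra_simps)
  \<comment> \<open>Modulo v . u = 0 the equation det E = 0 becomes the vanishing of E at the pair
    (v, u), the last entry of the block.\<close>
  then have q: "e 1 2 * e 2 3 * e 3 1 + e 1 3 * e 2 1 * e 3 2 + e 1 3 * e 3 1 * e 3 3 + e 1 2 * e 2 1 * e 2 2 = 0"
    unfolding r' by (simp add: algebra_simps)
  consider "e 2 1 = 0 \<and> e 3 1 = 0" | "e 1 2 = 0 \<and> e 1 3 = 0" | "e 2 1 \<noteq> 0 \<or> e 3 1 \<noteq> 0" "e 1 2 \<noteq> 0 \<or> e 1 3 \<noteq> 0"
    by blast
  then show ?thesis
  proof cases
    case 1
    have "D *v axis 1 1 = 0" "E *v axis 1 1 = 0"
      using 1 e11 by (simp_all add: vec_eq_iff forall_3 matrix_vector_mult_def sum_3 axis_def D_nth e_def)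
    then have "Q *v axis 1 1 \<noteq> 0 \<and> M *v (Q *v axis 1 1) = 0 \<and> N *v (Q *v axis 1 1) = 0"
      unfolding ev MN by (simp add: vec_eq_iff axis_def)
    then show ?thesis by blast
  next
    case 2
    have "transpose D *v axis 1 1 = 0" "transpose E *v axis 1 1 = 0"
      using 2 e11 by (simp_all add: vec_eq_iff forall_3 matrix_vector_mult_def sum_3 axis_def D_nth e_def transpose_def
        del: transpose_matrix_vector)
    then have "transpose P *v axis 1 1 \<noteq> 0 \<and> transpose M *v (transpose P *v axis 1 1) = 0 \<and>
        transpose N *v (transpose P *v axis 1 1) = 0"
      unfolding ev MN by (simp add: vec_eq_iff axis_def)
    then show ?thesis by blast
  next
    case 3
    define u v :: "complex^3" where "u = vector [0, e 2 1, e 3 1]" and "v = vector [0, e 1 2, e 1 3]"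
    have i: "indep (axis 1 1) u" "indep (axis 1 1) v"
      using 3 by (auto simp: indep_def u_def v_def vec_eq_iff forall_3 axis_def)
    have z: "dot x (D *v y) = 0 \<and> dot x (E *v y) = 0" if "x \<in> {axis 1 1, v}" "y \<in> {axis 1 1, u}" for x y
      using that r q e11
      by (auto simp: dot_expand matrix_vector_mult_def sum_3 axis_def D_nth e_def[symmetric] u_def v_def algebra_simps)
    have "dot x (M *v y) = 0 \<and> dot x (N *v y) = 0"
      if xy: "x \<in> {transpose P *v axis 1 1, transpose P *v v}" "y \<in> {Q *v axis 1 1, Q *v u}" for x y
    proof -
      obtain x' y' where "x' \<in> {axis 1 1, v}" "y' \<in> {axis 1 1, u}" "x = transpose P *v x'" "y = Q *v y'"
        using xy by blast
      then show ?thesis using z[of x' y'] unfolding ev by (simp only: dot_transpose)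
    qed
    moreover have "indep (transpose P *v axis 1 1) (transpose P *v v)" "indep (Q *v axis 1 1) (Q *v u)"
      using i inv by (auto intro!: indep_image simp del: transpose_matrix_vector)
    ultimately show ?thesis by blast
  qed
qed

text \<open>The normal form requires \<open>M\<close> or \<open>N\<close> to have rank two. If both
  have kernels of dimension at least two, these planes meet in C^3 and there is a common kernel
  vector.\<close>

lemma singular_pencil_3:
  fixes M N :: "complex^3^3"
  assumes sing: "\<And>s t. det (\<chi> i j. s * M $ i $ j + t * N $ i $ j) = 0"
  shows "(\<exists>c. c \<noteq> 0 \<and> M *v c = 0 \<and> N *v c = 0) \<or>
    (\<exists>b. b \<noteq> 0 \<and> transpose M *v b = 0 \<and> transpose N *v b = 0) \<or>
    (\<exists>b b' c c'. indep b b' \<and> indep c c' \<and>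
      (\<forall>x\<in>{b, b'}. \<forall>y\<in>{c, c'}. dot x (M *v y) = 0 \<and> dot x (N *v y) = 0))"
proof (cases "\<exists>u v. indep u v \<and> M *v u = 0 \<and> M *v v = 0")
  case False
  moreover have "det M = 0" using sing[of 1 0] by simp
  ultimately obtain P Q where "det P \<noteq> 0" "det Q \<noteq> 0"
    "P ** M ** Q = (\<chi> i j. if i = j \<and> i \<noteq> 1 then 1 else 0)"
    using singular_3_normal_form by blast
  from singular_pencil_3_aux[OF sing this] show ?thesis .
next
  case True
  then obtain u v where uv: "indep u v" "M *v u = 0" "M *v v = 0" by blast
  show ?thesis
  proof (cases "\<exists>u v. indep u v \<and> N *v u = 0 \<and> N *v v = 0")
    case False
    moreover have "det N = 0" using sing[of 0 1] by simp
    ultimately obtain P Q where PQ: "det P \<noteq> 0" "det Q \<noteq> 0"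
      "P ** N ** Q = (\<chi> i j. if i = j \<and> i \<noteq> 1 then 1 else 0)"
      using singular_3_normal_form by blast
    have "det (\<chi> i j. s * N $ i $ j + t * M $ i $ j) = 0" for s t
      using sing[of t s] by (simp add: add.commute)
    from singular_pencil_3_aux[OF this PQ] show ?thesis by blast
  next
    case True
    then obtain u' v' where uv': "indep u' v'" "N *v u' = 0" "N *v v' = 0" by blast
    obtain w where w: "invertible (vector [w, u', v'] :: complex^3^3)" using uv'(1) indep_extend by blast
    obtain r1 s1 t1 r2 s2 t2 where "u = r1 *s w + s1 *s u' + t1 *s v'" "v = r2 *s w + s2 *s u' + t2 *s v'"
      using invertible_vector_3_span[OF w] by metis
    then have N: "N *v u = r1 *s (N *v w)" "N *v v = r2 *s (N *v w)"
      using uv'(2,3) by (simp_all add: matrix_vector_right_distrib vector_scalar_commute)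
    \<comment> \<open>\<open>N\<close> sees only the coordinate along \<open>w\<close>, so on the
      span of \<open>u\<close> and \<open>v\<close> it is governed by the single linear form with
      coefficients \<open>r1\<close>, \<open>r2\<close>.\<close>
    have "\<exists>s t. (s \<noteq> 0 \<or> t \<noteq> 0) \<and> s * r1 + t * r2 = 0"
    proof (cases "r1 = 0")
      case True
      then show ?thesis by (intro exI[of _ 1] exI[of _ 0]) auto
    next
      case False
      then show ?thesis by (intro exI[of _ r2] exI[of _ "- r1"]) auto
    qed
    then obtain s t where st: "s \<noteq> 0 \<or> t \<noteq> 0" "s * r1 + t * r2 = 0" by blast
    have "N *v (s *s u + t *s v) = (s * r1 + t * r2) *s (N *v w)"
      by (simp add: matrix_vector_right_distrib vector_scalar_commute N vec_eq_iff algebra_simps)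
    then have "s *s u + t *s v \<noteq> 0" "N *v (s *s u + t *s v) = 0"
      using st uv(1) indep_scale_nonzero by auto
    then show ?thesis using uv
      by (intro disjI1 exI[of _ "s *s u + t *s v"]) (simp add: matrix_vector_right_distrib vector_scalar_commute)
  qed
qed

section \<open>The three slicings of a tensor\<close>

definition slice :: "complex^(3 \<times> 3 \<times> 3) \<Rightarrow> complex^3 \<Rightarrow> complex^3^3" where
  "slice T a = (\<chi> j k. \<Sum>i\<in>UNIV. a $ i * T $ (i, j, k))"

lemma slice_lincomb: "slice T (s *s a + t *s b) $ j $ k = s * slice T a $ j $ k + t * slice T b $ j $ k"
  by (simp add: slice_def sum_3 algebra_simps)

lemma dot_slice: "dot b (slice T a *v c) = tau T a b c"
  by (simp add: dot_expand slice_def matrix_vector_mult_def tau_expand sum_3 algebra_simps)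

lemma dot_slice_transpose: "dot c (transpose (slice T a) *v b) = tau T a b c"
  by (simp add: dot_expand slice_def matrix_vector_mult_def vector_matrix_mult_def transpose_def tau_expand sum_3 algebra_simps
     del: transpose_matrix_vector)

text \<open>Slices of \<open>rot T\<close> are slices of \<open>T\<close> in its third factor, those
  of \<open>rot (rot T)\<close> slices in its second; statements about the first factor thus cover
  all three.\<close>

definition rot :: "complex^(3 \<times> 3 \<times> 3) \<Rightarrow> complex^(3 \<times> 3 \<times> 3)" where
  "rot T = (\<chi> t. T $ (fst (snd t), snd (snd t), fst t))"

lemma rot_nth [simp]: "rot T $ (i, j, k) = T $ (j, k, i)"
  by (simp add: rot_def)

lemma tau_rot: "tau (rot T) a b c = tau T b c a"
  by (simp add: tau_expand algebra_simps)

lemma zero_block_rot: "zero_block (rot T) \<Longrightarrow> zero_block T"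
  unfolding zero_block_def tau_rot by metis

definition singular_on_plane :: "complex^(3 \<times> 3 \<times> 3) \<Rightarrow> bool" where
  "singular_on_plane T \<longleftrightarrow> (\<exists>a a'. indep a a' \<and> (\<forall>s t. det (slice T (s *s a + t *s a')) = 0))"

definition rank_one_slice :: "complex^(3 \<times> 3 \<times> 3) \<Rightarrow> bool" where
  "rank_one_slice T \<longleftrightarrow> (\<exists>a \<beta> \<gamma>. a \<noteq> 0 \<and> (\<forall>b c. tau T a b c = dot \<beta> b * dot \<gamma> c))"

text \<open>In its first argument the form factors through the quotient of C^3 by the plane of
  \<open>a\<close> and \<open>a'\<close>. That is a line, with coordinate \<open>f\<close> along
  \<open>w\<close>.\<close>

lemma rank_one_of_kernel_plane:
  assumes "indep a a'" "\<And>c. tau T a b c = 0" "\<And>c. tau T a' b c = 0"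
  shows "\<exists>\<alpha> \<gamma>. \<forall>a c. tau T a b c = dot \<alpha> a * dot \<gamma> c"
proof -
  obtain w where w: "invertible (vector [w, a, a'] :: complex^3^3)" using assms(1) indep_extend by blast
  define f where "f i = (SOME r. \<exists>s t. axis i 1 = r *s w + s *s a + t *s a')" for i
  have "\<exists>s t. axis i 1 = f i *s w + s *s a + t *s a'" for i
    unfolding f_def by (rule someI_ex) (use invertible_vector_3_span[OF w] in blast)
  then obtain s t where st: "\<And>i. axis i 1 = f i *s w + s i *s a + t i *s a'" by metis
  have "tau T (axis i 1) b c = f i * tau T w b c" for i c
    unfolding st using assms(2,3) by (simp add: tau_add tau_scale)
  then have "tau T x b c = dot (\<chi> i. f i) x * dot (\<chi> k. tau T w b (axis k 1)) c" for x c
    unfolding tau_dot(3)[symmetric] tau_dot(1)[of T x] by (simp add: dot_expand algebra_simps)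
  then show ?thesis by blast
qed

lemma singular_on_plane_cases:
  assumes "singular_on_plane T"
  shows "zero_block T \<or> rank_one_slice (rot T) \<or> rank_one_slice (rot (rot T))"
proof -
  obtain a a' where a: "indep a a'" and d: "\<And>s t. det (slice T (s *s a + t *s a')) = 0"
    using assms unfolding singular_on_plane_def by blast
  have "det (\<chi> i j. s * slice T a $ i $ j + t * slice T a' $ i $ j) = 0" for s t
    using d[of s t] unfolding slice_lincomb[symmetric] by simp
  from singular_pencil_3[OF this]
  consider c where "c \<noteq> 0" "slice T a *v c = 0" "slice T a' *v c = 0"
    | b where "b \<noteq> 0" "transpose (slice T a) *v b = 0" "transpose (slice T a') *v b = 0"
    | b b' c c' where "indep b b'" "indep c c'"
      "\<forall>x\<in>{b, b'}. \<forall>y\<in>{c, c'}. dot x (slice T a *v y) = 0 \<and> dot x (slice T a' *v y) = 0"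
    by blast
  then show ?thesis
  proof cases
    case 1
    then have *: "tau T a b c = 0" "tau T a' b c = 0" for b
      by (simp_all add: dot_slice[symmetric] dot_expand)
    \<comment> \<open>The last two factors are exchanged because the kernel vector \<open>c\<close>
      sits in the third factor, while the lemma expects it in the second.\<close>
    have "\<exists>\<alpha> \<gamma>. \<forall>x y. tau (\<chi> t. T $ (fst t, snd (snd t), fst (snd t))) x c y = dot \<alpha> x * dot \<gamma> y"
      by (rule rank_one_of_kernel_plane[OF a]) (use * in \<open>simp_all add: tau_expand algebra_simps\<close>)
    moreover have "tau (\<chi> t. T $ (fst t, snd (snd t), fst (snd t))) x c y = tau T x y c" for x y
      by (simp add: tau_expand algebra_simps)
    ultimately show ?thesis
      unfolding rank_one_slice_def tau_rot using 1(1) by metis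
  next
    case 2
    then have "tau T a b c = 0" "tau T a' b c = 0" for c
      by (simp_all only: dot_slice_transpose[symmetric]) (simp_all add: dot_expand)
    from rank_one_of_kernel_plane[OF a this] show ?thesis
      unfolding rank_one_slice_def tau_rot using 2(1) by (metis mult.commute)
  next
    case 3
    then show ?thesis unfolding zero_block_def dot_slice using a by blast
  qed
qed

lemma rank_one_slice_pair:
  assumes "rank_one_slice T" "rank_one_slice (rot (rot T))"
  shows "zero_block T"
  using assms rank_one_slices_zero_block unfolding rank_one_slice_def tau_rot by (metis mult.commute)

lemma rot_rot_rot [simp]: "rot (rot (rot T)) = T"
  by (simp add: vec_eq_iff)

text \<open>Without a vanishing block, each slicing yields a rank-one slice in one of the other two
  directions. Hence at least two directions have one, and any two suffice.\<close>

lemma singular_on_planes_zero_block: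
  assumes "singular_on_plane T" "singular_on_plane (rot T)" "singular_on_plane (rot (rot T))"
  shows "zero_block T"
proof -
  have "zero_block T \<or> rank_one_slice (rot T) \<or> rank_one_slice (rot (rot T))"
    "zero_block T \<or> rank_one_slice (rot (rot T)) \<or> rank_one_slice T"
    "zero_block T \<or> rank_one_slice T \<or> rank_one_slice (rot T)"
    using assms[THEN singular_on_plane_cases] zero_block_rot by auto
  moreover have "rank_one_slice T \<Longrightarrow> rank_one_slice (rot (rot T)) \<Longrightarrow> zero_block T"
    "rank_one_slice (rot T) \<Longrightarrow> rank_one_slice T \<Longrightarrow> zero_block T"
    "rank_one_slice (rot (rot T)) \<Longrightarrow> rank_one_slice (rot T) \<Longrightarrow> zero_block T"
    using rank_one_slice_pair[of T] rank_one_slice_pair[of "rot T"] rank_one_slice_pair[of "rot (rot T)"]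
      zero_block_rot by auto
  ultimately show ?thesis by blast
qed

section \<open>Ternary cubics annihilated by a traceless derivation\<close>

text \<open>The polar form of a ternary cubic, whose values are those of \<open>P\<close> on the
  diagonal, up to normalisation.\<close>

locale symmetric_trilinear =
  fixes P :: "complex^3 \<Rightarrow> complex^3 \<Rightarrow> complex^3 \<Rightarrow> complex"
  assumes add1: "P (u + u') v w = P u v w + P u' v w"
    and scale1: "P (s *s u) v w = s * P u v w"
    and swap12: "P u v w = P v u w"
    and swap23: "P u v w = P u w v"
begin

lemma add2: "P u (v + v') w = P u v w + P u v' w" and add3: "P u v (w + w') = P u v w + P u v w'"
  by (metis add1 swap12 swap23)+

lemma scale2: "P u (s *s v) w = s * P u v w" and scale3: "P u v (s *s w) = s * P u v w"
  by (metis scale1 swap12 swap23)+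

lemmas linear = add1 add2 add3 scale1 scale2 scale3

text \<open>Up to binomial factors, the four values are the coefficients of the cubic restricted to
  the plane.\<close>

definition vanishes_on_plane :: bool where
  "vanishes_on_plane \<longleftrightarrow> (\<exists>f g. indep f g \<and> P f f f = 0 \<and> P f f g = 0 \<and> P f g g = 0 \<and> P g g g = 0)"

lemma vanishes_on_planeD:
  assumes vanishes_on_plane
  obtains f g where "indep f g" "\<And>s t. P (s *s f + t *s g) (s *s f + t *s g) (s *s f + t *s g) = 0"
proof -
  obtain f g where *: "indep f g" "P f f f = 0" "P f f g = 0" "P f g g = 0" "P g g g = 0"
    using assms unfolding vanishes_on_plane_def by blast
  then have "P f g f = 0" "P g f f = 0" "P g f g = 0" "P g g f = 0"
    by (metis swap12 swap23)+
  with * show thesis by (intro that[of f g]) (simp_all add: linear)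
qed

end

section \<open>Triangular form of a 3 x 3 matrix\<close>

lemma trace_triangular_basis:
  fixes X :: "complex^3^3"
  assumes inv: "invertible (vector [e1, e2, e3] :: complex^3^3)"
    and X3: "X *v e3 = c *s e3" and X2: "X *v e2 = b *s e2 + q *s e3"
    and X1: "X *v e1 = a *s e1 + p *s e2 + r *s e3"
  shows "trace X = a + b + c"
proof -
  define B where "B = transpose (vector [e1, e2, e3] :: complex^3^3)"
  have "invertible B" using inv by (simp add: B_def invertible_det_nz)
  then obtain B' where B': "B' ** B = mat 1" "B ** B' = mat 1" unfolding invertible_def by blast
  define U :: "complex^3^3" where "U = vector [vector [a, 0, 0], vector [p, b, 0], vector [r, q, c]]"
  have "X ** B = B ** U"
    using X1 X2 X3
    by (simp add: vec_eq_iff forall_3 matrix_matrix_mult_def matrix_vector_mult_def B_def U_def transpose_def sum_3 mult.commute)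
  then have "X = B ** U ** B'" using B' by (metis matrix_mul_assoc matrix_mul_rid)
  then have "trace X = trace (U ** (B' ** B))" by (metis matrix_mul_assoc trace_mul_sym)
  then show ?thesis using B' by (simp add: trace_def sum_3 U_def)
qed

lemma eigenvalue_exists:
  fixes X :: "complex^3^3"
  shows "\<exists>a v. v \<noteq> 0 \<and> X *v v = a *s v"
proof -
  define p where "p = det (\<chi> i j. if i = j then [:X$i$j, -1:] else [:X$i$j:])"
  have "coeff p 3 = - 1"
    by (simp add: p_def det_3 numeral_3_eq_3)
  then have "degree p \<noteq> 0" by (metis coeff_eq_0 neg_equal_0_iff_equal not_gr_zero zero_less_numeral zero_neq_one)
  then obtain z where z: "poly p z = 0" using poly_root_exists by blast
  have "poly p z = det (\<chi> i j. X$i$j - (if i = j then z else 0))"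
    by (simp add: p_def det_3 algebra_simps)
  with z have "det (\<chi> i j. X$i$j - (if i = j then z else 0)) = 0" by simp
  then obtain v where "v \<noteq> 0" "(\<chi> i j. X$i$j - (if i = j then z else 0)) *v v = 0"
    unfolding det_0_iff_ker by blast
  then show ?thesis
    by (intro exI[of _ z] exI[of _ v]) (simp add: vec_eq_iff forall_3 matrix_vector_mult_def sum_3 algebra_simps)
qed

lemma kernel_plane_span:
  assumes "\<phi> \<noteq> 0" "indep u v" "dot \<phi> u = 0" "dot \<phi> v = 0" "dot \<phi> x = 0"
  shows "\<exists>s t. x = s *s u + t *s v"
proof -
  obtain w where w: "invertible (vector [w, u, v] :: complex^3^3)" using assms indep_extend by blast
  have sp: "\<exists>r s t. y = r *s w + s *s u + t *s v" for y using invertible_vector_3_span[OF w] .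
  have "dot \<phi> w \<noteq> 0"
  proof
    assume "dot \<phi> w = 0"
    then have "dot \<phi> y = 0" for y using sp[of y] assms by (auto simp: dot_add dot_scale)
    from this[of "axis 1 1"] this[of "axis 2 1"] this[of "axis 3 1"] show False
      using assms(1) by (simp add: dot_expand axis_def vec_eq_iff forall_3)
  qed
  moreover obtain r s t where x: "x = r *s w + s *s u + t *s v" using sp by blast
  ultimately have "r = 0" using assms by (simp add: dot_add dot_scale)
  with x show ?thesis by auto
qed

text \<open>An eigenvector \<phi> of the transpose has an invariant plane as its kernel. An
  eigenvector \<open>e3\<close> in that plane, a completion \<open>e2\<close> within it and any
  complement \<open>e1\<close> form the basis; \<phi> shows that \<open>X *v e1 - a *s e1\<close>
  falls into the plane.\<close>

lemma triangular_basis: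
  fixes X :: "complex^3^3"
  obtains e1 e2 e3 a b c p q r where "invertible (vector [e1, e2, e3] :: complex^3^3)"
    "X *v e3 = c *s e3" "X *v e2 = b *s e2 + q *s e3" "X *v e1 = a *s e1 + p *s e2 + r *s e3"
proof -
  obtain a \<phi> where \<phi>: "\<phi> \<noteq> 0" "transpose X *v \<phi> = a *s \<phi>" using eigenvalue_exists by blast
  have dX: "dot \<phi> (X *v x) = a * dot \<phi> x" for x
    unfolding dot_transpose[symmetric] \<phi>(2) by (simp add: dot_expand algebra_simps)
  obtain u v where uv: "indep u v" "dot \<phi> u = 0" "dot \<phi> v = 0" using dot_kernel by blast
  obtain k l where Xu: "X *v u = k *s u + l *s v" using kernel_plane_span[OF \<phi>(1) uv] dX uv by (metis mult_zero_right)
  obtain m n where Xv: "X *v v = m *s u + n *s v" using kernel_plane_span[OF \<phi>(1) uv] dX uv by (metis mult_zero_right)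
  \<comment> \<open>The quadratic form is the determinant expressing that \<open>X\<close> maps
    \<open>s *s u + t *s v\<close> to a multiple of itself.\<close>
  obtain s t where st: "s \<noteq> 0 \<or> t \<noteq> 0" "- l * s^2 + (k - n) * s * t + m * t^2 = 0" using binary_quadratic_zero by blast
  define e3 where "e3 = s *s u + t *s v"
  have X3: "X *v e3 = (s * k + t * m) *s u + (s * l + t * n) *s v"
    by (simp add: e3_def matrix_vector_right_distrib vector_scalar_commute Xu Xv vec_eq_iff algebra_simps)
  have det: "(s * k + t * m) * t = (s * l + t * n) * s" using st(2) by (simp add: power2_eq_square algebra_simps)
  have "\<exists>c. s * k + t * m = c * s \<and> s * l + t * n = c * t"
  proof (cases "s = 0")
    case True
    with st have "t \<noteq> 0" by blast
    with True det show ?thesis by (intro exI[of _ "(s * l + t * n) / t"]) auto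
  next
    case False
    then show ?thesis using det by (intro exI[of _ "(s * k + t * m) / s"]) (auto simp: field_simps)
  qed
  then obtain c where c: "s * k + t * m = c * s" "s * l + t * n = c * t" by blast
  have "X *v e3 = c *s e3" unfolding X3 c by (simp add: e3_def vec_eq_iff algebra_simps)
  moreover have "e3 \<noteq> 0" unfolding e3_def using st(1) uv(1) indep_scale_nonzero by blast
  then obtain e2 where e2: "indep e3 e2" "dot \<phi> e2 = 0" using indep_in_kernel by blast
  have \<phi>3: "dot \<phi> e3 = 0" using uv by (simp add: e3_def dot_add dot_scale)
  note span = kernel_plane_span[OF \<phi>(1) e2(1) \<phi>3 e2(2)]
  obtain b q where "X *v e2 = q *s e3 + b *s e2" using span dX e2(2) by (metis mult_zero_right)
  moreover have "indep e2 e3" using e2(1) unfolding indep_def by (metis add.commute)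
  then obtain e1 where "invertible (vector [e1, e2, e3] :: complex^3^3)" using indep_extend by blast
  moreover have "dot \<phi> (X *v e1 + (- a) *s e1) = 0" unfolding dot_add dot_scale dX by simp
  then obtain p r where "X *v e1 + (- a) *s e1 = r *s e3 + p *s e2" using span by blast
  then have "X *v e1 = a *s e1 + p *s e2 + r *s e3" by (simp add: vec_eq_iff algebra_simps)
  ultimately show thesis using that by (metis add.commute)
qed

lemma eigenvectors_indep:
  fixes X :: "complex^3^3"
  assumes "u \<noteq> 0" "v \<noteq> 0" "X *v u = l *s u" "X *v v = m *s v" "l \<noteq> m"
  shows "indep u v"
proof (rule indepI)
  fix s t assume *: "s *s u + t *s v = 0"
  then have "X *v (s *s u + t *s v) = 0" by simp
  then have "s *s (l *s u) + t *s (m *s v) = 0"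
    by (simp add: matrix_vector_right_distrib vector_scalar_commute assms)
  then have "s * (l * u $ i) + t * (m * v $ i) = 0" for i by (simp add: vec_eq_iff mult.assoc)
  moreover have "s * u $ i + t * v $ i = 0" for i using * by (simp add: vec_eq_iff)
  moreover have "(l - m) * s * u $ i = (s * (l * u $ i) + t * (m * v $ i)) - m * (s * u $ i + t * v $ i)" for i
    by (simp add: algebra_simps)
  ultimately have "((l - m) * s) *s u = 0"
    by (simp add: vec_eq_iff)
  then have "s = 0" using assms by simp
  with * show "s = 0 \<and> t = 0" using assms(2) by simp
qed

section \<open>Cubics annihilated by a traceless matrix\<close>

context symmetric_trilinear begin

context
  fixes X :: "complex^3^3"
  assumes inv: "\<And>u v w. P (X *v u) v w + P u (X *v v) w + P u v (X *v w) = 0"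
begin

text \<open>On binary cubics in this plane the derivation is 3 l plus a nilpotent map, hence
  injective.\<close>

lemma invariant_generalized_eigenspace:
  assumes "indep f g" "X *v f = l *s f + p *s g" "X *v g = l *s g" "l \<noteq> 0"
  shows vanishes_on_plane
proof -
  have s: "P g f g = P f g g" "P g g f = P f g g" "P f g f = P f f g" "P g f f = P f f g"
    by (metis swap12 swap23)+
  have 1: "P g g g = 0" using inv[of g g g] assms(4) by (simp add: assms linear)
  have 2: "P f g g = 0" using inv[of f g g] assms(4) by (simp add: assms linear s 1)
  have 3: "P f f g = 0" using inv[of f f g] assms(4) by (simp add: assms linear s 1 2)
  have 4: "P f f f = 0" using inv[of f f f] assms(4) by (simp add: assms linear s 1 2 3)
  from 1 2 3 4 assms(1) show ?thesis unfolding vanishes_on_plane_def by blast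
qed

text \<open>On the span of two eigenvectors the derivation is diagonal with weights 3l, 2l + m, l +
  2m, 3m. As the trace is zero, 2l + m is l minus the third eigenvalue, hence nonzero, and likewise
  l + 2m. It remains to choose two nonzero eigenvalues.\<close>

lemma invariant_eigenvectors:
  assumes "e1 \<noteq> 0" "e2 \<noteq> 0" "e3 \<noteq> 0"
    and X: "X *v e1 = a *s e1" "X *v e2 = b *s e2" "X *v e3 = c *s e3"
    and ne: "a \<noteq> b" "b \<noteq> c" "a \<noteq> c" and abc: "a + b + c = 0"
  shows vanishes_on_plane
proof -
  have plane: vanishes_on_plane
    if "u \<noteq> 0" "v \<noteq> 0" "X *v u = l *s u" "X *v v = m *s v" "l \<noteq> m" "l \<noteq> 0" "m \<noteq> 0" "2 * l + m \<noteq> 0" "l + 2 * m \<noteq> 0" for u v l m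
  proof -
    have "(l + l + l) * P u u u = 0" "(2 * l + m) * P u u v = 0" "(l + 2 * m) * P u v v = 0" "(m + m + m) * P v v v = 0"
      using inv[of u u u] inv[of u u v] inv[of u v v] inv[of v v v] that by (simp_all add: linear algebra_simps)
    then show ?thesis using that eigenvectors_indep[of u v X l m] unfolding vanishes_on_plane_def by auto
  qed
  have c: "c = - a - b" using abc by (simp add: eq_neg_iff_add_eq_0 algebra_simps)
  have n: "2 * a + b \<noteq> 0" "a + 2 * b \<noteq> 0" using ne unfolding c by (auto simp: algebra_simps eq_neg_iff_add_eq_0)
  consider "a \<noteq> 0" "b \<noteq> 0" | "a = 0" "b \<noteq> 0" "c \<noteq> 0" | "b = 0" "a \<noteq> 0" "c \<noteq> 0" using c ne by force
  then show ?thesis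
  proof cases
    case 1 then show ?thesis using plane[of e1 e2 a b] assms n by auto
  next
    case 2 then show ?thesis using plane[of e2 e3 b c] assms c by auto
  next
    case 3 then show ?thesis using plane[of e1 e3 a c] assms c by auto
  qed
qed

text \<open>The derivation is the coordinate along \<open>f\<close> times the partial derivative
  along \<open>w\<close>, so the cubic is a cone with vertex \<open>w\<close>. Its base is a binary
  cubic on the span of \<open>f\<close> and \<open>g\<close>; a zero \<open>h\<close> of it spans
  the plane together with \<open>w\<close>.\<close>

lemma invariant_square_zero:
  assumes i: "invertible (vector [f, g, w] :: complex^3^3)"
    and X: "X *v f = w" "X *v g = 0" "X *v w = 0"
  shows vanishes_on_plane
proof -
  have z: "P 0 u v = 0" "P u 0 v = 0" "P u v 0 = 0" for u v
    using scale1[of 0] scale2[of _ 0] scale3[of _ _ 0] by auto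
  have s: "P f w f = P w f f" "P f f w = P w f f" "P g w f = P w f g" "P f w g = P w f g" "P w g f = P w f g" "P f g w = P w f g"
     "P g w g = P w g g" "P g g w = P w g g"
     "P f w w = P w w f" "P w f w = P w w f" "P g w w = P w w g" "P w g w = P w w g" for f g w
    by (metis swap12 swap23)+
  have 1: "P w f f = 0" using inv[of f f f] by (simp add: X s)
  have 2: "P w f g = 0" using inv[of f f g] by (simp add: X s z)
  have 3: "P w g g = 0" using inv[of f g g] by (simp add: X s z)
  have 4: "P w w f = 0" using inv[of w f f] by (simp add: X s z)
  have 5: "P w w g = 0" using inv[of w f g] by (simp add: X s z)
  have 6: "P w w w = 0" using inv[of w w f] by (simp add: X s z)
  obtain x y where xy: "x \<noteq> 0 \<or> y \<noteq> 0"
    "P f f f * x^3 + (3 * P f f g) * x^2 * y + (3 * P f g g) * x * y^2 + P g g g * y^3 = 0"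
    using binary_cubic_zero by blast
  define h where "h = x *s f + y *s g"
  have fg: "P f g f = P f f g" "P g f f = P f f g" "P g f g = P f g g" "P g g f = P f g g"
    by (metis swap12 swap23)+
  have "P h h h = P f f f * x^3 + (3 * P f f g) * x^2 * y + (3 * P f g g) * x * y^2 + P g g g * y^3"
    unfolding h_def linear fg by (simp add: power2_eq_square power3_eq_cube algebra_simps)
  then have "P h h h = 0" using xy(2) by simp
  moreover have "P w h h = 0" "P w w h = 0" unfolding h_def linear using 2 swap23[of w g f] by (simp_all add: 1 3 4 5)
  moreover have "indep w h"
  proof (rule indepI)
    fix s t assume "s *s w + t *s h = 0"
    then have "(t * x) *s f + (t * y) *s g + s *s w = 0" by (simp add: h_def vec_eq_iff algebra_simps)
    with i have "t * x = 0 \<and> t * y = 0 \<and> s = 0" unfolding invertible_vector_3_iff by blast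
    with xy(1) show "s = 0 \<and> t = 0" by auto
  qed
  ultimately show ?thesis using 6 unfolding vanishes_on_plane_def by blast
qed

text \<open>The cubics annihilated by a regular nilpotent are spanned by x^3 and x q, with x the
  coordinate along \<open>e1\<close> and q an annihilated conic. All of them vanish where x =
  0.\<close>

lemma invariant_regular_nilpotent:
  assumes i: "indep e2 e3"
    and X: "X *v e3 = 0" "X *v e2 = q *s e3" "X *v e1 = p *s e2 + r *s e3" and pq: "p \<noteq> 0" "q \<noteq> 0"
  shows vanishes_on_plane
proof -
  have z: "P 0 u v = 0" "P u 0 v = 0" "P u v 0 = 0" for u v
    using scale1[of 0] scale2[of _ 0] scale3[of _ _ 0] by auto
  have s: "P e2 e3 e2 = P e2 e2 e3" "P e3 e2 e2 = P e2 e2 e3" "P e3 e2 e3 = P e2 e3 e3" "P e3 e3 e2 = P e2 e3 e3"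
    "P e1 e3 e2 = P e1 e2 e3"
    by (metis swap12 swap23)+
  have 1: "P e3 e3 e3 = 0" using inv[of e2 e3 e3] pq by (simp add: X linear z)
  have 2: "P e2 e3 e3 = 0" using inv[of e2 e2 e3] pq by (simp add: X linear z s)
  have 3: "P e2 e2 e3 = 0" using inv[of e2 e2 e2] pq by (simp add: X linear z s)
  have 4: "P e1 e3 e3 = 0" using inv[of e1 e2 e3] pq by (simp add: X linear z s 1 2 3)
  have "2 * p * P e1 e2 e3 = 0" using inv[of e1 e1 e3] swap12[of _ e1] 4 by (simp add: X linear z s)
  then have 5: "P e1 e2 e3 = 0" using pq by simp
  have 6: "P e2 e2 e2 = 0" using inv[of e1 e2 e2] pq by (simp add: X linear z s 1 2 3 4 5)
  from i 1 2 3 6 show ?thesis unfolding vanishes_on_plane_def by blast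
qed

text \<open>By the coincidences among the eigenvalues: three distinct ones give eigenvectors; a
  double one is nonzero, since otherwise the trace would make all three zero, and has a generalized
  eigenspace of dimension two; a triple one is zero and \<open>X\<close> is nilpotent.\<close>

lemma invariant_traceless_vanishes_on_plane:
  assumes tr: "trace X = 0" and nz: "X \<noteq> 0"
  shows vanishes_on_plane
proof -
  obtain e1 e2 e3 a b c p q r where i: "invertible (vector [e1, e2, e3] :: complex^3^3)"
    and X: "X *v e3 = c *s e3" "X *v e2 = b *s e2 + q *s e3" "X *v e1 = a *s e1 + p *s e2 + r *s e3"
    using triangular_basis .
  have ind: "x = 0 \<and> y = 0 \<and> z = 0" if "x *s e1 + y *s e2 + z *s e3 = 0" for x y z
    using i that unfolding invertible_vector_3_iff by blast
  have nz3: "x *s e1 + y *s e2 + z *s e3 \<noteq> 0" if "x \<noteq> 0 \<or> y \<noteq> 0 \<or> z \<noteq> 0" for x y z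
    using ind that by blast
  have abc: "a + b + c = 0" using trace_triangular_basis[OF i X] tr by simp
  have Xl: "X *v (x *s e1 + y *s e2 + z *s e3) = (x * a) *s e1 + (x * p + y * b) *s e2 + (x * r + y * q + z * c) *s e3" for x y z
    by (simp add: matrix_vector_right_distrib vector_scalar_commute X vec_eq_iff algebra_simps)
  have div: "k + k / (l - m) * m = l * (k / (l - m))" if "l \<noteq> m" for k l m :: complex
    using that by (simp add: field_simps)
  consider "a \<noteq> b" "b \<noteq> c" "a \<noteq> c" | "a = b" "b \<noteq> c" | "b = c" "a \<noteq> b" | "a = c" "a \<noteq> b" | "a = b" "b = c" by blast
  then show ?thesis
  proof cases
    case 1
    define y where "y = q / (b - c)"
    define x where "x = p / (a - b)"
    define z where "z = (r + x * q) / (a - c)"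
    have "q + y * c = b * y" "p + x * b = a * x" "r + x * q + z * c = a * z"
      using 1 div[of b c q] div[of a b p] div[of a c "r + x * q"] by (simp_all add: x_def y_def z_def)
    then have "X *v (1 *s e1 + x *s e2 + z *s e3) = a *s (1 *s e1 + x *s e2 + z *s e3)"
      "X *v (0 *s e1 + 1 *s e2 + y *s e3) = b *s (0 *s e1 + 1 *s e2 + y *s e3)"
      "X *v (0 *s e1 + 0 *s e2 + 1 *s e3) = c *s (0 *s e1 + 0 *s e2 + 1 *s e3)"
      unfolding Xl by (simp_all add: vec_eq_iff algebra_simps)
    from invariant_eigenvectors[OF nz3 nz3 nz3 this 1 abc] show ?thesis by simp
  next
    case 2
    \<comment> \<open>Corrections by multiples of \<open>e3\<close> that move \<open>e2\<close> and
      \<open>e1\<close> into the generalized eigenspace of the double eigenvalue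
      \<open>a\<close>.\<close>
    define y where "y = q / (b - c)"
    define z where "z = (r - p * y) / (a - c)"
    have "q + y * c = b * y" using 2 div[of b c q] by (simp add: y_def)
    moreover have "r - p * y + z * c = a * z" using 2 div[of a c "r - p * y"] by (simp add: z_def)
    then have "r + z * c = a * z + p * y" by (simp add: algebra_simps)
    ultimately have e: "q + y * c = b * y" "r + z * c = a * z + p * y" by blast+
    have X12: "X *v (1 *s e1 + 0 *s e2 + z *s e3) = a *s (1 *s e1 + 0 *s e2 + z *s e3) + p *s (0 *s e1 + 1 *s e2 + y *s e3)"
      "X *v (0 *s e1 + 1 *s e2 + y *s e3) = a *s (0 *s e1 + 1 *s e2 + y *s e3)"
      unfolding Xl using e 2 by (simp_all add: vec_eq_iff algebra_simps)
    have "indep (1 *s e1 + 0 *s e2 + z *s e3) (0 *s e1 + 1 *s e2 + y *s e3)"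
    proof (rule indepI)
      fix s t assume "s *s (1 *s e1 + 0 *s e2 + z *s e3) + t *s (0 *s e1 + 1 *s e2 + y *s e3) = 0"
      then have "s *s e1 + t *s e2 + (s * z + t * y) *s e3 = 0" by (simp add: vec_eq_iff algebra_simps)
      from ind[OF this] show "s = 0 \<and> t = 0" by blast
    qed
    moreover have "a \<noteq> 0" using 2 abc by auto
    ultimately show ?thesis using invariant_generalized_eigenspace X12 by blast
  next
    case 3
    have "indep e2 e3"
    proof (rule indepI)
      fix s t assume "s *s e2 + t *s e3 = 0"
      then show "s = 0 \<and> t = 0" using ind[of 0 s t] by simp
    qed
    moreover have "b \<noteq> 0" using 3 abc by auto
    ultimately show ?thesis using invariant_generalized_eigenspace[of e2 e3 b q] X 3 by simp
  next
    case 4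
    define y where "y = p / (a - b)"
    have e: "p + y * b = a * y" using 4 by (simp add: y_def field_simps)
    have "X *v (1 *s e1 + y *s e2 + 0 *s e3) = a *s (1 *s e1 + y *s e2 + 0 *s e3) + (r + y * q) *s e3"
      unfolding Xl using e by (simp add: vec_eq_iff)
    note Xf = this
    have ind1: "indep (1 *s e1 + y *s e2 + 0 *s e3) e3"
    proof (rule indepI)
      fix s t assume "s *s (1 *s e1 + y *s e2 + 0 *s e3) + t *s e3 = 0"
      then have "s *s e1 + (s * y) *s e2 + t *s e3 = 0" by (simp add: vec_eq_iff algebra_simps)
      from ind[OF this] show "s = 0 \<and> t = 0" by blast
    qed
    have "X *v e3 = a *s e3" "a \<noteq> 0" using X(1) 4 abc by auto
    from invariant_generalized_eigenspace[OF ind1 Xf this] show ?thesis .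
  next
    case 5
    then have "3 * a = 0" using abc by simp
    then have z: "a = 0" "b = 0" "c = 0" using 5 by auto
    have X3: "X *v e3 = 0" and X2: "X *v e2 = q *s e3" and X1: "X *v e1 = p *s e2 + r *s e3"
      using X z by simp_all
    \<comment> \<open>The square of \<open>X\<close> sends \<open>e1\<close> to
      \<open>(p * q) *s e3\<close>. Unless \<open>p\<close> and \<open>q\<close> are both nonzero it
      is therefore zero, and the middle three cases only differ in the triple \<open>f\<close>,
      \<open>g\<close>, \<open>w\<close>.\<close>
    consider "p \<noteq> 0" "q \<noteq> 0" | "p = 0" "r \<noteq> 0" | "p = 0" "r = 0" "q \<noteq> 0" | "q = 0" "p \<noteq> 0" | "p = 0" "q = 0" "r = 0" by blast
    then show ?thesis
    proof cases
      case 1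
      have "indep e2 e3"
      proof (rule indepI)
        fix s t assume "s *s e2 + t *s e3 = 0"
        then show "s = 0 \<and> t = 0" using ind[of 0 s t] by simp
      qed
      then show ?thesis using invariant_regular_nilpotent X3 X2 X1 1 by blast
    next
      case 2
      have "invertible (vector [e1, e2 + (- (q / r)) *s e1, r *s e3] :: complex^3^3)"
        unfolding invertible_vector_3_iff
      proof (intro allI impI)
        fix x y z assume "x *s e1 + y *s (e2 + (- (q / r)) *s e1) + z *s (r *s e3) = 0"
        then have "(x - y * (q / r)) *s e1 + y *s e2 + (z * r) *s e3 = 0" by (simp add: vec_eq_iff algebra_simps)
        from ind[OF this] show "x = 0 \<and> y = 0 \<and> z = 0" using 2 by auto
      qed
      moreover have "X *v (e2 + (- (q / r)) *s e1) = 0"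
        unfolding matrix_vector_right_distrib vector_scalar_commute X2 X1 using 2 by (simp add: vec_eq_iff)
      moreover have "X *v e1 = r *s e3" "X *v (r *s e3) = 0" using X1 X3 2 by (simp_all add: vector_scalar_commute)
      ultimately show ?thesis using invariant_square_zero by blast
    next
      case 3
      have "invertible (vector [e2, e1, q *s e3] :: complex^3^3)"
        unfolding invertible_vector_3_iff
      proof (intro allI impI)
        fix x y z assume "x *s e2 + y *s e1 + z *s (q *s e3) = 0"
        then have "y *s e1 + x *s e2 + (z * q) *s e3 = 0" by (simp add: vec_eq_iff algebra_simps)
        from ind[OF this] show "x = 0 \<and> y = 0 \<and> z = 0" using 3 by auto
      qed
      moreover have "X *v e1 = 0" "X *v (q *s e3) = 0" using X1 X3 3 by (simp_all add: vector_scalar_commute)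
      ultimately show ?thesis using invariant_square_zero X2 by blast
    next
      case 4
      have "invertible (vector [e1, e3, p *s e2 + r *s e3] :: complex^3^3)"
        unfolding invertible_vector_3_iff
      proof (intro allI impI)
        fix x y z assume "x *s e1 + y *s e3 + z *s (p *s e2 + r *s e3) = 0"
        then have "x *s e1 + (z * p) *s e2 + (y + z * r) *s e3 = 0" by (simp add: vec_eq_iff algebra_simps)
        from ind[OF this] show "x = 0 \<and> y = 0 \<and> z = 0" using 4 by auto
      qed
      moreover have "X *v (p *s e2 + r *s e3) = 0"
        using X2 X3 4 by (simp add: matrix_vector_right_distrib vector_scalar_commute)
      ultimately show ?thesis using invariant_square_zero X1 X3 by blast
    next
      case 5
      have "X *v x = 0" for x
      proof -
        obtain x1 x2 x3 where "x = x1 *s e1 + x2 *s e2 + x3 *s e3" using invertible_vector_3_span[OF i] by blast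
        then show ?thesis using Xl[of x1 x2 x3] z 5 by simp
      qed
      then have "X = 0" by (simp add: matrix_eq)
      with nz show ?thesis by blast
    qed
  qed
qed

end

end

text \<open>Ten points of the plane that impose independent conditions on cubics.\<close>

definition cubic_nodes :: "(complex^3) set" where
  "cubic_nodes = set [axis 1 1, axis 2 1, axis 3 1,
     axis 1 1 + axis 2 1, axis 1 1 + (-1) *s axis 2 1, axis 1 1 + axis 3 1, axis 1 1 + (-1) *s axis 3 1,
     axis 2 1 + axis 3 1, axis 2 1 + (-1) *s axis 3 1, axis 1 1 + axis 2 1 + axis 3 1]"

lemma card_cubic_nodes: "card cubic_nodes \<le> 10"
  unfolding cubic_nodes_def by (rule order.trans[OF card_length]) simp

context symmetric_trilinear begin

text \<open>The nodes e_i + e_j and e_i - e_j give the sum and the difference of the two mixed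
  values for each pair; then e_1 + e_2 + e_3 isolates the value at three distinct unit
  vectors.\<close>

lemma vanishes_at_cubic_nodes:
  assumes "\<And>v. v \<in> cubic_nodes \<Longrightarrow> P v v v = 0"
  shows "P u v w = 0"
proof -
  define e where "e i = (axis i 1 :: complex^3)" for i :: 3
  have s: "P y x x = P x x y" "P x y x = P x x y" "P y x y = P x y y" "P y y x = P x y y" for x y
    by (metis swap12 swap23)+
  have d: "P (e i) (e i) (e i) = 0" for i
    using assms exhaust_3[of i] by (auto simp: cubic_nodes_def e_def)
  have pair: "P x x y = 0 \<and> P x y y = 0"
    if "P x x x = 0" "P y y y = 0" "P (x + y) (x + y) (x + y) = 0" "P (x + (-1) *s y) (x + (-1) *s y) (x + (-1) *s y) = 0" for x y
  proof -
    have "P (x + y) (x + y) (x + y) = 3 * P x x y + 3 * P x y y"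
      unfolding linear by (simp add: that s(1)[of y x] s(2)[of x y] s(3)[of y x] s(4)[of y x])
    moreover have "P (x + (-1) *s y) (x + (-1) *s y) (x + (-1) *s y) = - 3 * P x x y + 3 * P x y y"
      unfolding linear by (simp add: that s(1)[of y x] s(2)[of x y] s(3)[of y x] s(4)[of y x])
    ultimately have "3 * P x x y + 3 * P x y y = 0" "- 3 * P x x y + 3 * P x y y = 0" using that by simp_all
    then have "6 * P x y y = 0" "6 * P x x y = 0" by algebra+
    then show ?thesis by simp
  qed
  have p: "P (e 1) (e 1) (e 2) = 0 \<and> P (e 1) (e 2) (e 2) = 0" "P (e 1) (e 1) (e 3) = 0 \<and> P (e 1) (e 3) (e 3) = 0"
    "P (e 2) (e 2) (e 3) = 0 \<and> P (e 2) (e 3) (e 3) = 0"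
    using assms by (intro pair d; simp add: cubic_nodes_def e_def)+
  have q: "P (e i) (e j) (e k) = 0" if "i = j \<or> j = k \<or> i = k" for i j k
    using that p d s exhaust_3[of i] exhaust_3[of j] exhaust_3[of k] by metis
  have t: "P (e 2) (e 1) (e 3) = P (e 1) (e 2) (e 3)" "P (e 1) (e 3) (e 2) = P (e 1) (e 2) (e 3)"
    "P (e 3) (e 1) (e 2) = P (e 1) (e 2) (e 3)" "P (e 2) (e 3) (e 1) = P (e 1) (e 2) (e 3)"
    "P (e 3) (e 2) (e 1) = P (e 1) (e 2) (e 3)"
    by (metis swap12 swap23)+
  have "P (e 1 + e 2 + e 3) (e 1 + e 2 + e 3) (e 1 + e 2 + e 3) = 6 * P (e 1) (e 2) (e 3)"
    unfolding linear by (simp add: q t)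
  then have "P (e 1) (e 2) (e 3) = 0" using assms by (simp add: cubic_nodes_def e_def)
  then have z: "P (e i) (e j) (e k) = 0" for i j k
    using q t exhaust_3[of i] exhaust_3[of j] exhaust_3[of k] by metis
  have x: "x$1 *s e 1 + x$2 *s e 2 + x$3 *s e 3 = x" for x
    by (simp add: vec_eq_iff forall_3 e_def axis_def)
  have "P (u$1 *s e 1 + u$2 *s e 2 + u$3 *s e 3) (v$1 *s e 1 + v$2 *s e 2 + v$3 *s e 3)
      (w$1 *s e 1 + w$2 *s e 2 + w$3 *s e 3) = 0"
    unfolding linear z by simp
  then show ?thesis unfolding x .
qed

text \<open>The derivative of the cubic along \<open>X\<close> is again a cubic, with polar form
  \<open>?L\<close> and diagonal values \<open>3 * P v v (X *v v)\<close>; so the ten nodes decide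
  whether it is zero.\<close>

lemma derivation_vanishes_on_plane:
  assumes "trace X = 0" "X \<noteq> 0" "\<And>v. v \<in> cubic_nodes \<Longrightarrow> P v v (X *v v) = 0"
  shows vanishes_on_plane
proof (rule invariant_traceless_vanishes_on_plane)
  let ?L = "\<lambda>u v w. P (X *v u) v w + P u (X *v v) w + P u v (X *v w)"
  interpret L: symmetric_trilinear ?L
  proof
    fix u u' v w s
    show "?L (u + u') v w = ?L u v w + ?L u' v w" by (simp add: linear matrix_vector_right_distrib)
    show "?L (s *s u) v w = s * ?L u v w" by (simp add: linear vector_scalar_commute algebra_simps)
    show "?L u v w = ?L v u w" using swap12 by (simp add: add.commute)
    show "?L u v w = ?L u w v" using swap23 by (simp add: add.commute add.left_commute)
  qed
  show "P (X *v u) v w + P u (X *v v) w + P u v (X *v w) = 0" for u v w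
  proof (rule L.vanishes_at_cubic_nodes)
    fix v :: "complex^3" assume "v \<in> cubic_nodes"
    moreover have "P (X *v v) v v = P v v (X *v v)" "P v (X *v v) v = P v v (X *v v)" by (metis swap12 swap23)+
    ultimately show "?L v v v = 0" using assms(3) by simp
  qed
qed (use assms in auto)

end

text \<open>The polarised determinant without the factor 1/6, over any commutative ring so that it
  applies both to matrices of polynomials and to their values.\<close>

definition mixed_det :: "'a::comm_ring_1^3^3 \<Rightarrow> 'a^3^3 \<Rightarrow> 'a^3^3 \<Rightarrow> 'a" where
  "mixed_det A B C =
     det (vector [A$1, B$2, C$3]) + det (vector [A$1, C$2, B$3]) + det (vector [B$1, A$2, C$3]) +
     det (vector [B$1, C$2, A$3]) + det (vector [C$1, A$2, B$3]) + det (vector [C$1, B$2, A$3])"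

lemma mixed_det_diag: "mixed_det A A A = 6 * det A"
proof -
  have "vector [A$1, A$2, A$3] = A" by (simp add: vec_eq_iff[of _ A] forall_3)
  then show ?thesis by (simp add: mixed_det_def)
qed

lemma symmetric_trilinear_mixed_det:
  "symmetric_trilinear (\<lambda>u v w. mixed_det (slice T u) (slice T v) (slice T w))"
proof
  fix u u' v w s
  show "mixed_det (slice T (u + u')) (slice T v) (slice T w) =
    mixed_det (slice T u) (slice T v) (slice T w) + mixed_det (slice T u') (slice T v) (slice T w)"
    using slice_lincomb[of T 1 u 1 u'] by (simp add: mixed_det_def det_3 algebra_simps)
  show "mixed_det (slice T (s *s u)) (slice T v) (slice T w) = s * mixed_det (slice T u) (slice T v) (slice T w)"
    using slice_lincomb[of T s u 0 u] by (simp add: mixed_det_def det_3 algebra_simps)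
qed (simp_all add: mixed_det_def add_ac)

lemma mixed_det_singular_on_plane:
  assumes "trace X = 0" "X \<noteq> 0"
    "\<And>v. v \<in> cubic_nodes \<Longrightarrow> mixed_det (slice T v) (slice T v) (slice T (X *v v)) = 0"
  shows "singular_on_plane T"
proof -
  interpret symmetric_trilinear "\<lambda>u v w. mixed_det (slice T u) (slice T v) (slice T w)"
    by (rule symmetric_trilinear_mixed_det)
  obtain f g where "indep f g" "\<And>s t. det (slice T (s *s f + t *s g)) = 0"
    using vanishes_on_planeD[OF derivation_vanishes_on_plane[OF assms]] by (auto simp: mixed_det_diag)
  then show ?thesis unfolding singular_on_plane_def by blast
qed

section \<open>The slice determinant of a restriction\<close>

definition det3 :: "(3 \<Rightarrow> complex) \<Rightarrow> (3 \<Rightarrow> complex) \<Rightarrow> (3 \<Rightarrow> complex) \<Rightarrow> complex" where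
  "det3 x y z = det (vector [vec_lambda x, vec_lambda y, vec_lambda z])"

lemma det3_expand: "det3 x y z = x 1 * y 2 * z 3 + x 2 * y 3 * z 1 + x 3 * y 1 * z 2
    - x 1 * y 3 * z 2 - x 2 * y 1 * z 3 - x 3 * y 2 * z 1"
  by (simp add: det3_def det_3 algebra_simps)

lemma cauchy_binet_3_4:
  "det (\<chi> j k. d1 j * c1 k + d2 j * c2 k + d3 j * c3 k + d4 j * c4 k) =
    det3 d1 d2 d3 * det3 c1 c2 c3 + det3 d1 d2 d4 * det3 c1 c2 c4 +
    det3 d1 d3 d4 * det3 c1 c3 c4 + det3 d2 d3 d4 * det3 c2 c3 c4"
  unfolding det_3 vec_lambda_beta det3_expand by algebra

text \<open>In each Cauchy-Binet minor two of the three vectors come from the same column of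
  \<open>A ** B j\<close>. They are combinations of the same \<open>x\<close> and \<open>y\<close>
  with the rows of \<open>A\<close> as coefficients, and \<open>det A\<close> splits off.\<close>

lemma det3_plane:
  "det3 (\<lambda>j. a * x j + b * y j) (\<lambda>j. c * x j + d * y j) (\<lambda>j. e * z j + f * w j) =
    (a * d - b * c) * (e * det3 x y z + f * det3 x y w)"
  "det3 (\<lambda>j. e * z j + f * w j) (\<lambda>j. a * x j + b * y j) (\<lambda>j. c * x j + d * y j) =
    (a * d - b * c) * (e * det3 z x y + f * det3 w x y)"
  unfolding det3_expand by algebra+

text \<open>The matrix is a product of a 3 x 4 and a 4 x 3 matrix. Left multiplication by
  \<open>A\<close> on 2 x 2 matrices is the direct sum of two copies of \<open>A\<close>, whose
  third exterior power is \<open>det A\<close> times a matrix linear in \<open>A\<close>.\<close>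

lemma det_trace_form:
  fixes B C :: "3 \<Rightarrow> complex^2^2"
  shows "\<exists>L :: complex^2^2. \<forall>A. det (\<chi> j k. trace (A ** B j ** C k)) =
    det A * (\<Sum>r\<in>UNIV. \<Sum>s\<in>UNIV. A $ r $ s * L $ r $ s)"
proof -
  define b11 b12 b21 b22 where "b11 j = B j $ 1 $ 1" and "b12 j = B j $ 1 $ 2"
    and "b21 j = B j $ 2 $ 1" and "b22 j = B j $ 2 $ 2" for j
  define c11 c12 c21 c22 where "c11 j = C j $ 1 $ 1" and "c12 j = C j $ 1 $ 2"
    and "c21 j = C j $ 2 $ 1" and "c22 j = C j $ 2 $ 2" for j
  let ?m4 = "det3 c11 c12 c21" let ?m3 = "det3 c11 c12 c22"
  let ?m2 = "det3 c11 c21 c22" let ?m1 = "det3 c12 c21 c22"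
  define L :: "complex^2^2" where "L = vector [
    vector [det3 b11 b21 b12 * ?m4 + det3 b11 b12 b22 * ?m2, det3 b11 b21 b22 * ?m4 + det3 b21 b12 b22 * ?m2],
    vector [det3 b11 b21 b12 * ?m3 + det3 b11 b12 b22 * ?m1, det3 b11 b21 b22 * ?m3 + det3 b21 b12 b22 * ?m1]]"
  have "det (\<chi> j k. trace (A ** B j ** C k)) = det A * (\<Sum>r\<in>UNIV. \<Sum>s\<in>UNIV. A $ r $ s * L $ r $ s)" for A
  proof -
    define d11 d21 d12 d22 where "d11 = (\<lambda>j. A$1$1 * b11 j + A$1$2 * b21 j)"
      and "d21 = (\<lambda>j. A$2$1 * b11 j + A$2$2 * b21 j)" and "d12 = (\<lambda>j. A$1$1 * b12 j + A$1$2 * b22 j)"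
      and "d22 = (\<lambda>j. A$2$1 * b12 j + A$2$2 * b22 j)"
    have "trace (A ** B j ** C k) = d11 j * c11 k + d21 j * c12 k + d12 j * c21 k + d22 j * c22 k" for j k
      by (simp add: trace_mult_3 sum_2 d11_def d21_def d12_def d22_def b11_def b12_def b21_def b22_def
          c11_def c12_def c21_def c22_def algebra_simps)
    then have "det (\<chi> j k. trace (A ** B j ** C k)) =
      det3 d11 d21 d12 * ?m4 + det3 d11 d21 d22 * ?m3 + det3 d11 d12 d22 * ?m2 + det3 d21 d12 d22 * ?m1"
      by (simp add: cauchy_binet_3_4)
    also have "\<dots> = det A * (\<Sum>r\<in>UNIV. \<Sum>s\<in>UNIV. A $ r $ s * L $ r $ s)"
      unfolding d11_def d21_def d12_def d22_def det3_plane
      by (simp add: L_def det_2 sum_2 algebra_simps)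
    finally show ?thesis .
  qed
  then show ?thesis by blast
qed

lemma restriction_slice_det:
  assumes "T \<in> triangle_restrictions"
  shows "\<exists>Q l. transpose Q = Q \<and> (\<forall>u. det (slice T u) = dot u (Q *v u) * dot l u)"
proof -
  obtain A B C :: "3 \<Rightarrow> complex^2^2" where T: "\<And>i j k. T $ (i, j, k) = trace (A i ** B j ** C k)"
    using assms unfolding triangle_restrictions_def by blast
  obtain L :: "complex^2^2" where L: "\<And>A. det (\<chi> j k. trace (A ** B j ** C k)) =
    det A * (\<Sum>r\<in>UNIV. \<Sum>s\<in>UNIV. A $ r $ s * L $ r $ s)" using det_trace_form[of B C] by blast
  have sl: "slice T u = (\<chi> j k. trace (lincomb A u ** B j ** C k))" for u
    unfolding trace_lincomb by (simp add: slice_def T)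
  \<comment> \<open>The polar form of the 2 x 2 determinant, pulled back along the linear family of
    the \<open>A i\<close>.\<close>
  define Q :: "complex^3^3" where "Q = (\<chi> i j. (A i$1$1 * A j$2$2 + A j$1$1 * A i$2$2 - A i$1$2 * A j$2$1 - A j$1$2 * A i$2$1) / 2)"
  define l :: "complex^3" where "l = (\<chi> i. \<Sum>r\<in>UNIV. \<Sum>s\<in>UNIV. A i $ r $ s * L $ r $ s)"
  have "transpose Q = Q" by (simp add: vec_eq_iff transpose_def Q_def algebra_simps)
  moreover have "det (lincomb A u) = dot u (Q *v u)" for u
    by (simp add: det_2 lincomb_def dot_expand matrix_vector_mult_def sum_3 Q_def field_simps)
  moreover have "(\<Sum>r\<in>UNIV. \<Sum>s\<in>UNIV. lincomb A u $ r $ s * L $ r $ s) = dot l u" for u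
    by (simp add: lincomb_def dot_expand sum_3 sum_2 l_def algebra_simps)
  ultimately show ?thesis unfolding sl L by metis
qed

lemma dot_commute: "dot u v = dot v u" and dot_zero: "dot 0 v = 0" "dot v 0 = 0"
  by (simp_all add: dot_expand mult.commute)

definition cross_matrix :: "complex^3 \<Rightarrow> complex^3^3" where
  "cross_matrix l = vector [vector [0, - l$3, l$2], vector [l$3, 0, - l$1], vector [- l$2, l$1, 0]]"

text \<open>If \<open>l \<times> Q v\<close> vanishes identically, then \<open>Q\<close> has rank at most one with image in the span of \<open>l\<close>, and any
  rank-one nilpotent \<open>X\<close> with image in the kernel of \<open>l\<close> will do.\<close>

lemma (in symmetric_trilinear) conic_line_derivation:
  assumes Q: "transpose Q = Q" and P: "\<And>u. P u u u = k * (dot u (Q *v u) * dot l u)"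
  shows "\<exists>X. X \<noteq> 0 \<and> trace X = 0 \<and> (\<forall>v. P v v (X *v v) = 0)"
proof -
  have s: "dot u (Q *v v) = dot v (Q *v u)" for u v
    using dot_transpose[of Q u v, unfolded Q] by (simp add: dot_commute)
  \<comment> \<open>Up to a factor \<open>P v v w\<close> is the derivative of the cubic at
    \<open>v\<close> along \<open>w\<close>, so it vanishes if \<open>w\<close> is tangent to both
    factors. Comparing the parameters 1 and -1 cancels the even terms, and \<open>P w w w\<close> is
    zero because \<open>dot l w\<close> is.\<close>
  have der: "P v v w = 0" if vw: "l = 0 \<or> dot v (Q *v w) = 0 \<and> dot l w = 0" for v w
  proof -
    have sw: "P v w v = P v v w" "P w v v = P v v w" "P w v w = P v w w" "P w w v = P v w w"
      by (metis swap12 swap23)+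
    have c: "P (v + t *s w) (v + t *s w) (v + t *s w) = P v v v + 3 * t * P v v w + 3 * t^2 * P v w w + t^3 * P w w w" for t
      unfolding linear sw by (simp add: power2_eq_square power3_eq_cube algebra_simps)
    have d: "dot (v + t *s w) u = dot v u + t * dot w u" for t u
      by (simp add: dot_expand algebra_simps)
    have "P (v + t *s w) (v + t *s w) (v + t *s w) = k * ((dot v (Q *v v) + t^2 * dot w (Q *v w)) * dot l v)" for t
      using vw s[of w v] unfolding P
      by (auto simp: matrix_vector_right_distrib vector_scalar_commute dot_add dot_scale d dot_zero power2_eq_square)
    from this[of 1] this[of "-1"]
    have "P v v v + 3 * P v v w + 3 * P v w w + P w w w = P v v v - 3 * P v v w + 3 * P v w w - P w w w"
      unfolding c by simp
    moreover have "P w w w = 0" using vw unfolding P by (auto simp: dot_zero)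
    ultimately have "6 * P v v w = 0" by simp
    then show ?thesis by simp
  qed
  show ?thesis
  proof (cases "l = 0")
    case True
    define X :: "complex^3^3" where "X = vector [vector [0, 1, 0], vector [0, 0, 0], vector [0, 0, 0]]"
    have "X $ 1 $ 2 \<noteq> 0" "trace X = 0" by (simp_all add: X_def trace_def sum_3)
    then show ?thesis using der True by (intro exI[of _ X]) auto
  next
    case False
    define R where "R = cross_matrix l ** Q"
    have R: "R *v v = cross_matrix l *v (Q *v v)" for v by (simp add: R_def matrix_vector_mul_assoc)
    show ?thesis
    proof (cases "R = 0")
      case False
      \<comment> \<open>The trace of an antisymmetric matrix times a symmetric one vanishes.\<close>
      have "trace R = 0"
        using symmetric_nth[OF Q, of 2 1] symmetric_nth[OF Q, of 3 1] symmetric_nth[OF Q, of 3 2]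
        by (simp add: R_def trace_def matrix_matrix_mult_def cross_matrix_def sum_3 algebra_simps)
      moreover have "dot x (cross_matrix l *v x) = 0" "dot l (cross_matrix l *v x) = 0" for x
        by (simp_all add: dot_expand matrix_vector_mult_def cross_matrix_def sum_3 algebra_simps)
      then have "P v v (R *v v) = 0" for v
        using der[of v "R *v v"] s[of v "R *v v"] by (simp add: R dot_commute)
      ultimately show ?thesis using False by blast
    next
      case True
      obtain i where li: "l $ i \<noteq> 0" using \<open>l \<noteq> 0\<close> by (auto simp: vec_eq_iff)
      obtain a where a: "a \<noteq> 0" "dot l a = 0" using dot_kernel_2 by blast
      obtain m where m: "m \<noteq> 0" "dot a m = 0" using dot_kernel_2 by blast
      have par: "l $ i * (Q *v v) $ j = l $ j * (Q *v v) $ i" for i j v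
        using R[of v] True exhaust_3[of i] exhaust_3[of j]
        by (auto simp: cross_matrix_def matrix_vector_mult_def[of "vector _"] sum_3 vec_eq_iff forall_3)
      have "l $ i * dot (Q *v v) a = (Q *v v) $ i * dot l a" for v
        using par[of i v 1] par[of i v 2] par[of i v 3]
        by (simp add: dot_expand distrib_left mult.assoc[symmetric])
      then have Qa: "dot (Q *v v) a = 0" for v using a li by simp
      define X :: "complex^3^3" where "X = (\<chi> r s. a $ r * m $ s)"
      have X: "X *v v = dot m v *s a" for v
        by (simp add: X_def matrix_vector_mult_def dot_expand sum_3 vec_eq_iff algebra_simps)
      have "X \<noteq> 0" using a m by (auto simp: X_def vec_eq_iff)
      moreover have "trace X = 0" using m(2) by (simp add: X_def trace_def sum_3 dot_expand)
      moreover have "P v v (X *v v) = 0" for v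
        using der[of v "X *v v"] s[of v "X *v v"] Qa[of v] a(2) by (simp add: X dot_scale dot_commute)
      ultimately show ?thesis by blast
    qed
  qed
qed

lemma restriction_derivation:
  assumes "T \<in> triangle_restrictions"
  shows "\<exists>X. X \<noteq> 0 \<and> trace X = 0 \<and> (\<forall>v. mixed_det (slice T v) (slice T v) (slice T (X *v v)) = 0)"
proof -
  interpret symmetric_trilinear "\<lambda>u v w. mixed_det (slice T u) (slice T v) (slice T w)"
    by (rule symmetric_trilinear_mixed_det)
  obtain Q l where "transpose Q = Q" "\<And>u. det (slice T u) = dot u (Q *v u) * dot l u"
    using restriction_slice_det[OF assms] by blast
  then show ?thesis by (intro conic_line_derivation[of Q 6 l]) (simp_all add: mixed_det_diag)
qed

lemma rot_triangle_restrictions: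
  assumes "T \<in> triangle_restrictions"
  shows "rot T \<in> triangle_restrictions"
proof -
  obtain A B C :: "3 \<Rightarrow> complex^2^2" where "\<And>i j k. T $ (i, j, k) = trace (A i ** B j ** C k)"
    using assms unfolding triangle_restrictions_def by blast
  then show ?thesis
    by (intro triangle_restrictionsI[of _ C A B]) (simp add: trace_mult_3 sum_2 algebra_simps)
qed

section \<open>The equations\<close>

lemma finite_surj_of_card_le:
  assumes "finite A" "A \<noteq> {}" "card A \<le> CARD('n::finite)"
  shows "\<exists>f :: 'n \<Rightarrow> 'a. range f = A"
proof -
  obtain g :: "'a \<Rightarrow> 'n" where "inj_on g A" "g ` A \<subseteq> UNIV"
    using card_le_inj[of A "UNIV :: 'n set"] assms by auto
  then show ?thesis using inj_on_iff_surj[OF assms(2), of "UNIV :: 'n set"] by blast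
qed

text \<open>Any enumeration serves, since the kernel of the matrix depends only on the set of its
  rows.\<close>

definition node :: "10 \<Rightarrow> complex^3" where
  "node = (SOME f. range f = cubic_nodes)"

lemma range_node: "range node = cubic_nodes"
proof -
  have "\<exists>f :: 10 \<Rightarrow> complex^3. range f = cubic_nodes"
    by (rule finite_surj_of_card_le) (use card_cubic_nodes in \<open>simp_all add: cubic_nodes_def\<close>)
  then show ?thesis unfolding node_def by (rule someI_ex)
qed

text \<open>The eight free entries of a traceless matrix; the entry (3,3) is determined by
  them.\<close>

definition sl3_position :: "8 \<Rightarrow> 3 \<times> 3" where
  "sl3_position = (SOME f. bij_betw f UNIV (UNIV - {(3, 3)}))"

lemma bij_sl3_position: "bij_betw sl3_position UNIV (UNIV - {(3, 3)})"
proof -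
  have "\<exists>f. bij_betw f (UNIV :: 8 set) (UNIV - {(3 :: 3, 3 :: 3)})"
    by (rule finite_same_card_bij) (auto simp: card_Diff_singleton)
  then show ?thesis unfolding sl3_position_def by (rule someI_ex)
qed

text \<open>The elementary matrices E_rs off the diagonal and E_rr - E_33 on it, so that coordinates
  are read off at \<open>sl3_position\<close>.\<close>

definition sl3_basis :: "8 \<Rightarrow> complex^3^3" where
  "sl3_basis j = (\<chi> r s. (if sl3_position j = (r, s) then 1 else 0) -
     (if r = 3 \<and> s = 3 \<and> fst (sl3_position j) = snd (sl3_position j) then 1 else 0))"

definition sl3_of :: "complex^8 \<Rightarrow> complex^3^3" where
  "sl3_of c = (\<chi> r s. \<Sum>j\<in>UNIV. c $ j * sl3_basis j $ r $ s)"

lemma sl3_of_nth: "sl3_of c $ fst (sl3_position j) $ snd (sl3_position j) = c $ j"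
proof -
  have i: "sl3_position k = sl3_position j \<longleftrightarrow> k = j" for k
    using bij_sl3_position by (auto simp: bij_betw_def inj_on_def)
  have "sl3_position j \<noteq> (3, 3)" using bij_sl3_position by (auto simp: bij_betw_def)
  then have b: "sl3_basis k $ fst (sl3_position j) $ snd (sl3_position j) = (if k = j then 1 else 0)" for k
    using i[of k] by (auto simp: sl3_basis_def prod_eq_iff)
  show ?thesis by (simp add: sl3_of_def b if_distrib cong: if_cong)
qed

lemma trace_sl3_of: "trace (sl3_of c) = 0"
proof -
  have "trace (sl3_basis j) = 0" for j
  proof -
    have "sl3_position j \<noteq> (3, 3)" using bij_sl3_position by (auto simp: bij_betw_def)
    then show ?thesis
      using exhaust_3[of "fst (sl3_position j)"] exhaust_3[of "snd (sl3_position j)"]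
      by (cases "sl3_position j") (auto simp: trace_def sl3_basis_def sum_3)
  qed
  then have "(\<Sum>j\<in>UNIV. c $ j * trace (sl3_basis j)) = 0" by simp
  then show ?thesis
    by (simp add: trace_def sl3_of_def sum_3 sum.distrib[symmetric] distrib_left)
qed

lemma sl3_of_surj:
  assumes "trace X = 0"
  shows "\<exists>c. X = sl3_of c"
proof -
  define c where "c = (\<chi> j. X $ fst (sl3_position j) $ snd (sl3_position j))"
  have e: "X $ r $ s = sl3_of c $ r $ s" if "(r, s) \<noteq> (3, 3)" for r s
  proof -
    have "(r, s) \<in> range sl3_position" using bij_sl3_position that by (simp add: bij_betw_def)
    then obtain j where "sl3_position j = (r, s)" by (metis imageE)
    then show ?thesis using sl3_of_nth[of c j] by (simp add: c_def)
  qed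
  moreover have "X $ 3 $ 3 = sl3_of c $ 3 $ 3"
    using assms trace_sl3_of[of c] e[of 1 1] e[of 2 2]
    by (simp add: trace_def sum_3) (metis add_left_cancel)
  ultimately have "X $ r $ s = sl3_of c $ r $ s" for r s by (metis prod.inject)
  then show ?thesis by (auto simp: vec_eq_iff)
qed

lemma sl3_of_eq_0_iff: "sl3_of c = 0 \<longleftrightarrow> c = 0"
proof
  assume "sl3_of c = 0"
  then show "c = 0" using sl3_of_nth[of c] by (simp add: vec_eq_iff)
qed (simp add: sl3_of_def vec_eq_iff)

lemma sl3_of_mult: "sl3_of c *v x = (\<Sum>j\<in>UNIV. c $ j *s (sl3_basis j *v x))"
  by (simp add: vec_eq_iff sl3_of_def matrix_vector_mult_def sum_3 sum.distrib[symmetric] algebra_simps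
      sum_distrib_left sum_distrib_right)

lemma (in symmetric_trilinear) sum3: "P u v (\<Sum>j\<in>I. c j *s f j) = (\<Sum>j\<in>I. c j * P u v (f j))"
proof -
  have "P u v 0 = 0" using scale3[of u v 0 0] by simp
  then show ?thesis by (induction I rule: infinite_finite_induct) (simp_all add: linear)
qed

text \<open>\<open>rot\<close> on indices: rotating a tensor becomes a renaming of the variables in
  \<open>slice_poly\<close>.\<close>

definition rotate_index :: "3 \<Rightarrow> 3 \<times> 3 \<times> 3 \<Rightarrow> 3 \<times> 3 \<times> 3" where
  "rotate_index l = (\<lambda>(i, j, k). if l = 1 then (i, j, k) else if l = 2 then (j, k, i) else (k, i, j))"

definition rotation :: "3 \<Rightarrow> complex^(3 \<times> 3 \<times> 3) \<Rightarrow> complex^(3 \<times> 3 \<times> 3)" where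
  "rotation l T = (\<chi> t. T $ rotate_index l t)"

lemma rotation_simps: "rotation 1 T = T" "rotation 2 T = rot T" "rotation 3 T = rot (rot T)"
  by (simp_all add: rotation_def rotate_index_def vec_eq_iff)

definition slice_poly :: "3 \<Rightarrow> complex^3 \<Rightarrow> (3 \<times> 3 \<times> 3) polynomial^3^3" where
  "slice_poly l u = (\<chi> j k. \<Sum>i\<in>UNIV.
     Poly_Mapping.single (Poly_Mapping.single (rotate_index l (i, j, k)) 1) (u $ i))"

lemma eval_slice_poly: "eval_poly (slice_poly l u $ j $ k) T = slice (rotation l T) u $ j $ k"
proof -
  have "eval_monomial (Poly_Mapping.single t 1) T = T $ t" for t
  proof -
    have "eval_monomial (Poly_Mapping.single t 1) T = (\<Prod>v\<in>UNIV. if v = t then T $ v else 1)"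
      unfolding eval_monomial_def by (rule prod.cong) (auto simp: lookup_single when_def)
    then show ?thesis by simp
  qed
  then show ?thesis
    by (simp add: slice_poly_def eval_poly_sum eval_poly_single slice_def rotation_def)
qed

lemma form_of_degree_slice_poly: "form_of_degree 1 (slice_poly l u $ j $ k)"
proof -
  have "form_of_degree 1 (Poly_Mapping.single (Poly_Mapping.single t 1) c)" for t :: "3 \<times> 3 \<times> 3" and c
  proof -
    have "(\<Sum>v\<in>UNIV. Poly_Mapping.lookup (Poly_Mapping.single t (1::nat)) v) = (\<Sum>v\<in>UNIV. if v = t then 1 else 0)"
      by (rule sum.cong) (auto simp: lookup_single when_def)
    then show ?thesis by (simp add: form_of_degree_def)
  qed
  then show ?thesis unfolding slice_poly_def vec_lambda_beta by (intro form_of_degree_sum)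
qed

lemma eval_mixed_det:
  fixes A B C :: "'v::finite polynomial^3^3"
  shows "eval_poly (mixed_det A B C) x = mixed_det (\<chi> i j. eval_poly (A $ i $ j) x)
     (\<chi> i j. eval_poly (B $ i $ j) x) (\<chi> i j. eval_poly (C $ i $ j) x)"
proof -
  have "eval_poly (det (vector [a, b, c])) x = det (vector [\<chi> j. eval_poly (a $ j) x,
      \<chi> j. eval_poly (b $ j) x, \<chi> j. eval_poly (c $ j) x])" for a b c :: "'v::finite polynomial^3"
    unfolding eval_poly_det by (simp add: det_3)
  then show ?thesis by (simp add: mixed_det_def eval_poly_add)
qed

lemma form_of_degree_mixed_det:
  fixes A B C :: "'v::finite polynomial^3^3"
  assumes "\<And>i j. form_of_degree d (A $ i $ j)" "\<And>i j. form_of_degree d (B $ i $ j)" "\<And>i j. form_of_degree d (C $ i $ j)"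
  shows "form_of_degree (3 * d) (mixed_det A B C)"
proof -
  have D: "form_of_degree (CARD(3) * d) (det (vector [x, y, z] :: 'v polynomial^3^3))"
    if "\<And>j. form_of_degree d (x $ j)" "\<And>j. form_of_degree d (y $ j)" "\<And>j. form_of_degree d (z $ j)" for x y z
  proof (rule form_of_degree_det)
    show "form_of_degree d ((vector [x, y, z] :: 'v polynomial^3^3) $ i $ j)" for i j
      using that exhaust_3[of i] by auto
  qed
  show ?thesis
    unfolding mixed_det_def by (intro form_of_degree_add D[simplified] assms)
qed

text \<open>Instead of the coefficients of \<open>X \<cdot> F\<close>, the rows record its values at the ten nodes, up to a
  common factor; this changes the matrix by an invertible one only.\<close>

definition equation_matrix :: "3 \<Rightarrow> (3 \<times> 3 \<times> 3) polynomial^8^10" where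
  "equation_matrix l = (\<chi> r j. mixed_det (slice_poly l (node r)) (slice_poly l (node r))
     (slice_poly l (sl3_basis j *v node r)))"

text \<open>The last argument of \<open>mixed_det\<close> enters linearly, so applying the matrix to
  \<open>c\<close> evaluates the derivation along \<open>sl3_of c\<close> at every node.\<close>

lemma equation_matrix_kernel:
  "(\<exists>c. c \<noteq> 0 \<and> (\<chi> r j. eval_poly (equation_matrix l $ r $ j) T) *v c = 0) \<longleftrightarrow>
   (\<exists>X. X \<noteq> 0 \<and> trace X = 0 \<and> (\<forall>v\<in>cubic_nodes.
      mixed_det (slice (rotation l T) v) (slice (rotation l T) v) (slice (rotation l T) (X *v v)) = 0))"
  (is "_ \<longleftrightarrow> (\<exists>X. X \<noteq> 0 \<and> trace X = 0 \<and> ?Z X)")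
proof -
  interpret symmetric_trilinear
    "\<lambda>u v w. mixed_det (slice (rotation l T) u) (slice (rotation l T) v) (slice (rotation l T) w)"
    by (rule symmetric_trilinear_mixed_det)
  have "((\<chi> r j. eval_poly (equation_matrix l $ r $ j) T) *v c) $ r =
    mixed_det (slice (rotation l T) (node r)) (slice (rotation l T) (node r)) (slice (rotation l T) (sl3_of c *v node r))" for c r
    unfolding sl3_of_mult sum3
    by (simp add: matrix_vector_mult_def equation_matrix_def eval_mixed_det eval_slice_poly mult.commute)
  then have "(\<chi> r j. eval_poly (equation_matrix l $ r $ j) T) *v c = 0 \<longleftrightarrow> (\<forall>v\<in>cubic_nodes.
      mixed_det (slice (rotation l T) v) (slice (rotation l T) v) (slice (rotation l T) (sl3_of c *v v)) = 0)" for c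
    unfolding range_node[symmetric] by (simp add: vec_eq_iff[of "_ *v _"])
  note kernel = this
  show ?thesis unfolding kernel
  proof
    assume "\<exists>c. c \<noteq> 0 \<and> ?Z (sl3_of c)"
    then obtain c where "c \<noteq> 0" "?Z (sl3_of c)" by blast
    then show "\<exists>X. X \<noteq> 0 \<and> trace X = 0 \<and> ?Z X"
      by (intro exI[of _ "sl3_of c"]) (simp add: sl3_of_eq_0_iff trace_sl3_of)
  next
    assume "\<exists>X. X \<noteq> 0 \<and> trace X = 0 \<and> ?Z X"
    then obtain X c where "X \<noteq> 0" "?Z X" "X = sl3_of c" using sl3_of_surj by metis
    then show "\<exists>c. c \<noteq> 0 \<and> ?Z (sl3_of c)"
      by (intro exI[of _ c]) (simp add: sl3_of_eq_0_iff)
  qed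
qed

theorem corollary5p6:
  shows "\<exists>M :: 3 \<Rightarrow> (3 \<times> 3 \<times> 3) polynomial^8^10.
    (\<forall>l i j. form_of_degree 3 (M l $ i $ j)) \<and>
    (\<forall>p \<in> (\<Union>l. maximal_minors (M l)). form_of_degree 24 p) \<and>
    set_theoretic_equations (\<Union>l. maximal_minors (M l))
      (TNS_triangle :: (complex^(3 \<times> 3 \<times> 3)) set)"
proof (intro exI[of _ equation_matrix] conjI ballI allI)
  show deg: "form_of_degree 3 (equation_matrix l $ i $ j)" for l i j
    using form_of_degree_mixed_det[OF form_of_degree_slice_poly form_of_degree_slice_poly form_of_degree_slice_poly]
    by (simp add: equation_matrix_def)
  show "form_of_degree 24 p" if "p \<in> (\<Union>l. maximal_minors (equation_matrix l))" for p
    using that form_of_degree_maximal_minor[of 3] deg by fastforce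
  let ?Z = "zero_locus (\<Union>l. maximal_minors (equation_matrix l))"
  have "triangle_restrictions \<subseteq> ?Z"
  proof
    fix T assume T: "T \<in> triangle_restrictions"
    then have "rotation l T \<in> triangle_restrictions" for l
      using exhaust_3[of l] rot_triangle_restrictions by (auto simp: rotation_simps)
    then show "T \<in> ?Z"
      unfolding zero_locus_maximal_minors equation_matrix_kernel using restriction_derivation by blast
  qed
  then have "TNS_triangle \<subseteq> ?Z"
    unfolding TNS_triangle_def tensor_map_triangle_image by (rule zariski_closure_subset)
  moreover have "?Z \<subseteq> TNS_triangle"
  proof
    fix T assume "T \<in> ?Z"
    then have "singular_on_plane (rotation l T)" for l
      unfolding zero_locus_maximal_minors equation_matrix_kernel using mixed_det_singular_on_plane by blast
    from this[of 1] this[of 2] this[of 3] have "zero_block T"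
      unfolding rotation_simps by (rule singular_on_planes_zero_block)
    then show "T \<in> TNS_triangle"
      using zero_block_closure closure_subset_zariski_closure
      unfolding TNS_triangle_def tensor_map_triangle_image by blast
  qed
  ultimately show "set_theoretic_equations (\<Union>l. maximal_minors (equation_matrix l)) TNS_triangle"
    unfolding set_theoretic_equations_def by blast
qed

end
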